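(* Let $n\ge 2$ and let $B(0,1)\subset\mathbf{R}^n$ be the open unit ball. There exist a function $u \in W^{1,1}_{\mathrm{loc}}(B(0,1))$ and an elliptic $A \in C(B(0,1); \mathbf{R}^{n \times n})$ such that $u$ is a weak solution of $-\operatorname{div}(A\nabla u)=0$ in $B(0,1)$, but for every $p>1$, $u \notin W^{1,p}_{\mathrm{loc}}(B(0,1))$.
   Context: Functions are real-valued. For an open set $\Omega\subset\mathbf{R}^n$, a bounded measurable map $A:\Omega\to\mathbf{R}^{n\times n}$ is called elliptic if $A(x)$ is a symmetric matrix for every $x\in\Omega$ and there exist constants $\lambda,\Lambda>0$ such that $\lambda|\xi|^2\le (A(x)\xi)\cdot\xi\le\Lambda|\xi|^2$ for every $x\in\Omega$ and $\xi\in\mathbf{R}^n$. A function $u\in W^{1,1}_{\mathrm{loc}}(\Omega)$ is a weak solution of $-\operatorname{div}(A\nabla u)=0$ in $\Omega$ if $\int_\Omega (A\nabla u)\cdot\nabla\varphi=0$ for every $\varphi\in C^1_c(\Omega)$. *)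

theory Defs
  imports "HOL-Analysis.Analysis"
begin

definition grad :: "(real^'n \<Rightarrow> real) \<Rightarrow> real^'n \<Rightarrow> real^'n" where
  "grad \<phi> x = (\<chi> i. frechet_derivative \<phi> (at x) (axis i 1))"

text \<open>Elements of \<open>C\<^sup>1\<^sub>c(\<Omega>)\<close> are represented by their extension by zero to the whole space.\<close>

definition C1_c :: "(real^'n) set \<Rightarrow> (real^'n \<Rightarrow> real) set" where
  "C1_c \<Omega> = {\<phi>. (\<forall>x. \<phi> differentiable (at x)) \<and> continuous_on UNIV (grad \<phi>) \<and>
      compact (closure {x. \<phi> x \<noteq> 0}) \<and> closure {x. \<phi> x \<noteq> 0} \<subseteq> \<Omega>}"

text \<open>Functions on \<open>\<Omega>\<close> are total functions whose values outside \<open>\<Omega>\<close> are irrelevant;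
  equivalence classes modulo null sets are represented by arbitrary Lebesgue measurable
  representatives.\<close>

definition Lp_loc :: "real \<Rightarrow> (real^'n) set \<Rightarrow> (real^'n \<Rightarrow> 'b::euclidean_space) set" where
  "Lp_loc p \<Omega> = {f. f \<in> borel_measurable (lebesgue_on \<Omega>) \<and>
      (\<forall>K. compact K \<longrightarrow> K \<subseteq> \<Omega> \<longrightarrow> set_integrable lebesgue K (\<lambda>x. norm (f x) powr p))}"

text \<open>Weak derivatives are tested against \<open>C\<^sup>1\<^sub>c(\<Omega>)\<close>, as in Gilbarg--Trudinger and Brezis;
  testing against smooth compactly supported functions gives the same notion.\<close>

definition has_weak_gradient ::
    "(real^'n) set \<Rightarrow> (real^'n \<Rightarrow> real) \<Rightarrow> (real^'n \<Rightarrow> real^'n) \<Rightarrow> bool" where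
  "has_weak_gradient \<Omega> u g \<longleftrightarrow> u \<in> Lp_loc 1 \<Omega> \<and> g \<in> Lp_loc 1 \<Omega> \<and>
      (\<forall>\<phi>\<in>C1_c \<Omega>. \<forall>i. (LINT x:\<Omega>|lebesgue. u x * grad \<phi> x $ i)
                       = - (LINT x:\<Omega>|lebesgue. g x $ i * \<phi> x))"

definition W1p_loc :: "real \<Rightarrow> (real^'n) set \<Rightarrow> (real^'n \<Rightarrow> real) set" where
  "W1p_loc p \<Omega> = {u. u \<in> Lp_loc p \<Omega> \<and> (\<exists>g. has_weak_gradient \<Omega> u g \<and> g \<in> Lp_loc p \<Omega>)}"

definition elliptic :: "(real^'n) set \<Rightarrow> (real^'n \<Rightarrow> real^'n^'n) \<Rightarrow> bool" where
  "elliptic \<Omega> A \<longleftrightarrow> bounded (A ` \<Omega>) \<and> A \<in> borel_measurable (lebesgue_on \<Omega>) \<and>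
      (\<forall>x\<in>\<Omega>. transpose (A x) = A x) \<and>
      (\<exists>l>0. \<exists>L>0. \<forall>x\<in>\<Omega>. \<forall>\<xi>.
          l * (norm \<xi>)\<^sup>2 \<le> (A x *v \<xi>) \<bullet> \<xi> \<and> (A x *v \<xi>) \<bullet> \<xi> \<le> L * (norm \<xi>)\<^sup>2)"

text \<open>The weak gradient \<open>g\<close> of \<open>u\<close> is unique up to null sets, so the integral below does not
  depend on the choice of \<open>g\<close>.\<close>

definition weak_solution ::
    "(real^'n) set \<Rightarrow> (real^'n \<Rightarrow> real^'n^'n) \<Rightarrow> (real^'n \<Rightarrow> real) \<Rightarrow> bool" where
  "weak_solution \<Omega> A u \<longleftrightarrow> u \<in> W1p_loc 1 \<Omega> \<and>
      (\<exists>g. has_weak_gradient \<Omega> u g \<and>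
        (\<forall>\<phi>\<in>C1_c \<Omega>. (LINT x:\<Omega>|lebesgue. (A x *v g x) \<bullet> grad \<phi> x) = 0))"

end

theory Submission
  imports Defs
begin

text \<open>
Let N be the dimension, s = |x|^2 and z = 1 / (16 - ln s). For a fixed coordinate x_k, the solution is
u = x_k |x|^(-N) z^2: a first derivative of the fundamental solution of the Laplace equation, damped by
a logarithm. Its gradient has the size |x|^(-N) z^2. In polar coordinates the integral of this near 0 is that of dr / (r (ln r)^2), so
the gradient is integrable (\<open>set_integrable_profile\<close>), but only because of the logarithm: any
power p > 1 of it behaves like |x|^(-N p) up to logarithms and is not integrable.

The damping destroys harmonicity, and the matrix A = I + c (I - x x^T / |x|^2) restores the equation: it
changes the conductivity in the directions tangential to spheres only. Off the origin the equation
div (A grad u) = 0 is then an algebraic equation for c(s), with the solution (24 z^2 - 4 N z) / (N - 1)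
(\<open>flux_divergence_free\<close>). It tends to 0 at the origin, so A is continuous, and z <= 1/16 gives
|c| <= 1/2, so A is elliptic (\<open>elliptic_coeff_matrix\<close>).

What happens at the origin is settled by \<open>divergence_theorem_removable_origin\<close>. Cutting a test function
\<open>\<phi>\<close> off near 0 produces an error governed by \<open>\<phi> (X \<bullet> x) / (x \<bullet> x)\<close>, where X is the field under
consideration. For the weak gradient, X is u times a unit vector and the error tends to 0. For the flux
X = A grad u, one replaces \<open>\<phi>\<close> by \<open>\<phi> - \<phi> 0\<close>, which gains a factor |x|; the constant contributes nothing,
since the flux is even and hence \<open>X \<bullet> x\<close> is odd.

Finally, no other choice of the weak gradient is better (\<open>dipole_notin_W1p_loc\<close>). Testing with a bump in the
ball of radius r/4 about the point at distance r from 0 on the k-th axis, where the k-th derivative of u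
has a fixed sign and the full size r^(-N) up to logarithms, bounds the integral of the p-th power of any
weak gradient from below by r^(-N (p - 1)) up to logarithms, for every small r.
\<close>

section \<open>Translation invariance and integrals of derivatives\<close>

lemma lborel_integral_translate:
  fixes f :: "'a::euclidean_space \<Rightarrow> real"
  assumes "f \<in> borel_measurable borel"
  shows "(LINT x|lborel. f (c + x)) = (LINT x|lborel. f x)"
proof -
  have "(LINT x|lborel. f x) = (LINT x|distr lborel borel ((+) c). f x)"
    by (simp only: lborel_distr_plus)
  also have "\<dots> = (LINT x|lborel. f (c + x))"
    using assms by (intro integral_distr) auto
  finally show ?thesis by simp
qed

lemma lborel_integral_reflect:
  fixes f :: "'a::euclidean_space \<Rightarrow> real"
  assumes "f \<in> borel_measurable borel"
  shows "(LINT x|lborel. f (- x)) = (LINT x|lborel. f x)"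
proof -
  have "(lborel :: 'a measure) = distr lborel borel (\<lambda>x. 0 + (-1) *\<^sub>R x)"
    by (subst lborel_affine[of "-1" 0]) (auto simp: density_1)
  then have eq: "(lborel :: 'a measure) = distr lborel borel uminus"
    by (simp add: fun_eq_iff cong: distr_cong)
  have "(LINT x|lborel. f x) = (LINT x|distr lborel borel uminus. f x)"
    by (simp only: eq[symmetric])
  also have "\<dots> = (LINT x|lborel. f (- x))"
    using assms by (intro integral_distr) auto
  finally show ?thesis by simp
qed

lemma lborel_integral_odd:
  fixes f :: "'a::euclidean_space \<Rightarrow> real"
  assumes "f \<in> borel_measurable borel" "\<And>x. f (- x) = - f x"
  shows "(LINT x|lborel. f x) = 0"
  using lborel_integral_reflect[OF assms(1)] by (simp add: assms(2))

text \<open>The integral of G is invariant under translation, so every difference quotient in the direction v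
integrates to 0. The quotients are bounded by the maximum of the derivative and live on a fixed ball,
so dominated convergence passes to the limit.\<close>

lemma integral_directional_derivative_eq_0:
  fixes G :: "'a::euclidean_space \<Rightarrow> real"
  assumes der: "\<And>x. (G has_derivative G' x) (at x)"
    and cont: "continuous_on UNIV (\<lambda>x. G' x v)"
    and supp: "\<And>x. R \<le> norm x \<Longrightarrow> G x = 0"
  shows "integrable lborel (\<lambda>x. G' x v)" and "(LINT x|lborel. G' x v) = 0"
proof -
  define t :: "nat \<Rightarrow> real" where "t k = 1 / (real k + 1)" for k
  have t: "0 < t k" "t k \<le> 1" for k by (auto simp: t_def)
  have t0: "t \<longlonglongrightarrow> 0" unfolding t_def using LIMSEQ_inverse_real_of_nat
    by (simp add: inverse_eq_divide add.commute)
  define q where "q k x = (G (t k *\<^sub>R v + x) - G x) / t k" for k x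
  have contG: "continuous_on UNIV G"
    using der by (meson continuous_at_imp_continuous_on has_derivative_continuous)
  have [measurable]: "G \<in> borel_measurable borel" "(\<lambda>x. G' x v) \<in> borel_measurable borel"
    using contG cont by (auto intro: borel_measurable_continuous_onI)
  have [measurable]: "q k \<in> borel_measurable borel" for k
    unfolding q_def[abs_def] by measurable
  have line: "((\<lambda>r. G (r *\<^sub>R v + x)) has_real_derivative G' (r *\<^sub>R v + x) v) (at r)" for r x
  proof -
    have "((\<lambda>r. G (r *\<^sub>R v + x)) has_derivative (\<lambda>h. G' (r *\<^sub>R v + x) (h *\<^sub>R v))) (at r)"
      by (rule has_derivative_compose[where g = G, OF _ der, simplified])
        (auto intro!: derivative_eq_intros)
    moreover have "G' (r *\<^sub>R v + x) (h *\<^sub>R v) = h * G' (r *\<^sub>R v + x) v" for h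
      using has_derivative_linear[OF der] linear_cmul by fastforce
    ultimately show ?thesis
      by (simp add: has_field_derivative_def mult.commute[of _ "G' _ v"])
  qed
  have "compact ((\<lambda>x. G' x v) ` cball 0 (R + 2 * norm v))"
    using cont by (intro compact_continuous_image) (auto intro: continuous_on_subset)
  then obtain M where M: "\<And>x. x \<in> cball 0 (R + 2 * norm v) \<Longrightarrow> \<bar>G' x v\<bar> \<le> M"
    using compact_imp_bounded bounded_iff by (metis image_eqI real_norm_def)
  \<comment> \<open>The quotients use steps of at most 1, hence vanish outside the support thickened by the norm of v.\<close>
  define w :: "'a \<Rightarrow> real" where "w x = indicator (cball 0 (R + norm v)) x * M" for x
  have w: "integrable lborel w"
    unfolding w_def
    using emeasure_bounded_finite[OF bounded_cball, of "0::'a" "R + norm v"]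
    by (intro integrable_mult_left) (auto intro!: integrable_real_indicator)
  have bound: "\<bar>q k x\<bar> \<le> w x" for k x
  proof (cases "x \<in> cball 0 (R + norm v)")
    case True
    obtain z where z: "0 < z" "z < t k"
      "G (t k *\<^sub>R v + x) - G (0 *\<^sub>R v + x) = (t k - 0) * G' (z *\<^sub>R v + x) v"
      using MVT2[OF t(1)[of k], of "\<lambda>r. G (r *\<^sub>R v + x)" "\<lambda>r. G' (r *\<^sub>R v + x) v"] line
      by auto
    have "q k x = G' (z *\<^sub>R v + x) v" using z t(1)[of k] by (simp add: q_def)
    moreover have "norm (z *\<^sub>R v + x) \<le> norm v + norm x"
      using norm_triangle_ineq[of "z *\<^sub>R v" x] mult_left_le_one_le[of "norm v" z] z t(2)[of k]
      by simp
    ultimately show ?thesis using M[of "z *\<^sub>R v + x"] True by (simp add: w_def)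
  next
    case False
    have "norm x - norm v \<le> norm x - norm (t k *\<^sub>R v)"
      using t[of k] mult_left_le_one_le[of "norm v" "t k"] by simp
    also have "\<dots> \<le> norm (t k *\<^sub>R v + x)"
      by (metis add.commute diff_minus_eq_add norm_minus_cancel norm_triangle_ineq2)
    finally have "R \<le> norm (t k *\<^sub>R v + x)" "R \<le> norm x"
      using False norm_ge_zero[of v] by (auto simp del: norm_ge_zero)
    then show ?thesis using False supp by (simp add: q_def w_def)
  qed
  have lim: "(\<lambda>k. q k x) \<longlonglongrightarrow> G' x v" for x
  proof -
    have "((\<lambda>h. (G ((0 + h) *\<^sub>R v + x) - G (0 *\<^sub>R v + x)) / h) \<longlongrightarrow> G' (0 *\<^sub>R v + x) v) (at 0)"
      using line[of x 0] unfolding DERIV_def .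
    moreover have "filterlim t (at 0) sequentially"
      using t0 t(1) by (auto simp: filterlim_at intro!: always_eventually) (metis less_irrefl)
    ultimately show ?thesis
      using filterlim_compose by (fastforce simp: q_def)
  qed
  have q0: "(LINT x|lborel. q k x) = 0" for k
  proof -
    have "integrable lborel (\<lambda>x. indicator (cball 0 R) x *\<^sub>R G x)"
      using contG by (intro borel_integrable_compact) (auto intro: continuous_on_subset)
    also have "(\<lambda>x. indicator (cball 0 R) x *\<^sub>R G x) = G"
      using supp by (force simp: indicator_def)
    finally have iG: "integrable lborel G" .
    then have "integrable (distr lborel borel ((+) (t k *\<^sub>R v))) G"
      by (simp only: lborel_distr_plus)
    then have "integrable lborel (\<lambda>x. G (t k *\<^sub>R v + x))"
      by (subst (asm) integrable_distr_eq) auto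
    with iG show ?thesis
      by (simp add: q_def lborel_integral_translate)
  qed
  show "integrable lborel (\<lambda>x. G' x v)"
    by (rule integrable_dominated_convergence[where w = w and s = q])
      (use w bound lim in auto)
  have "(\<lambda>k. LINT x|lborel. q k x) \<longlonglongrightarrow> (LINT x|lborel. G' x v)"
    by (rule integral_dominated_convergence[where w = w])
      (use w bound lim in auto)
  then show "(LINT x|lborel. G' x v) = 0"
    by (simp add: q0 LIMSEQ_const_iff)
qed

section \<open>A radial cut-off and test functions\<close>

text \<open>A cut-off of class C1 that is 0 up to 1 and tends to 1 at infinity without ever reaching it: a rational
function of the squared positive part is differentiated more easily than a spline that is eventually 1.\<close>

definition smooth_step :: "real \<Rightarrow> real" where
  "smooth_step t = 1 - 1 / (1 + (max 0 (t - 1))\<^sup>2)"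

definition smooth_step' :: "real \<Rightarrow> real" where
  "smooth_step' t = 2 * max 0 (t - 1) / (1 + (max 0 (t - 1))\<^sup>2)\<^sup>2"

lemma has_real_derivative_max_square:
  "((\<lambda>t::real. (max 0 t)\<^sup>2) has_real_derivative 2 * max 0 t) (at t)"
proof -
  consider "t < 0" | "t > 0" | "t = 0" by linarith
  then show ?thesis
  proof cases
    case 1
    have "((\<lambda>t::real. 0) has_real_derivative 0) (at t)" by simp
    then have "((\<lambda>t::real. (max 0 t)\<^sup>2) has_real_derivative 0) (at t)"
      by (rule has_field_derivative_transform_within_open[where S = "{..<0}"]) (use 1 in auto)
    with 1 show ?thesis by simp
  next
    case 2
    have "((\<lambda>t::real. t\<^sup>2) has_real_derivative 2 * t) (at t)"
      by (auto intro!: derivative_eq_intros)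
    then have "((\<lambda>t::real. (max 0 t)\<^sup>2) has_real_derivative 2 * t) (at t)"
      by (rule has_field_derivative_transform_within_open[where S = "{0<..}"]) (use 2 in auto)
    with 2 show ?thesis by simp
  next
    case 3
    have "((\<lambda>h::real. (max 0 h)\<^sup>2 / h) \<longlongrightarrow> 0) (at 0)"
    proof (rule Lim_null_comparison)
      show "\<forall>\<^sub>F h::real in at 0. norm ((max 0 h)\<^sup>2 / h) \<le> \<bar>h\<bar>"
        by (auto simp: power2_eq_square max_def)
      show "((\<lambda>h::real. \<bar>h\<bar>) \<longlongrightarrow> 0) (at 0)"
        by (rule tendsto_rabs_zero) simp
    qed
    with 3 show ?thesis by (simp add: DERIV_def)
  qed
qed

lemma has_real_derivative_smooth_step:
  "(smooth_step has_real_derivative smooth_step' t) (at t)"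
proof -
  have pos: "1 + (max 0 (t - 1))\<^sup>2 > (0::real)" for t
    by (simp add: add_pos_nonneg)
  have "((\<lambda>t. (max 0 (t - 1))\<^sup>2) has_real_derivative 2 * max 0 (t - 1)) (at t)"
  proof -
    have "((\<lambda>t. t - 1) has_real_derivative 1) (at t)"
      by (auto intro!: derivative_eq_intros)
    from DERIV_chain2[OF has_real_derivative_max_square this] show ?thesis by simp
  qed
  moreover have "((\<lambda>t. 1 - 1 / (1 + W t)) has_real_derivative d / (1 + W t)\<^sup>2) (at t)"
    if "(W has_real_derivative d) (at t)" "1 + W t \<noteq> 0" for W d
    using that by (auto intro!: derivative_eq_intros simp: power2_eq_square)
  ultimately show ?thesis
    unfolding smooth_step_def[abs_def] smooth_step'_def using pos[of t] by (metis less_irrefl)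
qed

lemma smooth_step_bounds: "0 \<le> smooth_step t" "smooth_step t \<le> 1"
proof -
  have "1 \<le> 1 + (max 0 (t - 1))\<^sup>2" by simp
  then have "1 / (1 + (max 0 (t - 1))\<^sup>2) \<le> 1" "0 \<le> 1 / (1 + (max 0 (t - 1))\<^sup>2)"
    by (simp_all only: divide_le_eq_1_pos zero_le_divide_1_iff)
  then show "0 \<le> smooth_step t" "smooth_step t \<le> 1"
    by (simp_all only: smooth_step_def)
qed

lemma smooth_step_eq_0: "t \<le> 1 \<Longrightarrow> smooth_step t = 0" "t \<le> 1 \<Longrightarrow> smooth_step' t = 0"
  by (auto simp: smooth_step_def smooth_step'_def)

lemma continuous_on_smooth_step [continuous_intros]:
  "continuous_on S f \<Longrightarrow> continuous_on S (\<lambda>x. smooth_step (f x))"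
  "continuous_on S f \<Longrightarrow> continuous_on S (\<lambda>x. smooth_step' (f x))"
proof -
  have "continuous_on UNIV smooth_step" "continuous_on UNIV smooth_step'"
    unfolding smooth_step_def[abs_def] smooth_step'_def[abs_def]
    by (auto intro!: continuous_intros simp: add_nonneg_eq_0_iff)
  then show "continuous_on S f \<Longrightarrow> continuous_on S (\<lambda>x. smooth_step (f x))"
    "continuous_on S f \<Longrightarrow> continuous_on S (\<lambda>x. smooth_step' (f x))"
    by (auto intro: continuous_on_compose2)
qed

text \<open>The left-hand side with t = a |x|^2 is the radial derivative of the cut-off, multiplied by |x|. Such a
quantity depends only on t, hence is bounded uniformly in the scale a; and for fixed x
it tends to 0 as a grows.\<close>

lemma smooth_step'_dilation_bound:
  assumes "0 \<le> t"
  shows "\<bar>2 * t * smooth_step' t\<bar> \<le> 8 / (1 + (max 0 (t - 1))\<^sup>2)"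
proof -
  define m where "m = max 0 (t - 1)"
  have m: "0 \<le> m" "t \<le> 1 + m" by (auto simp: m_def)
  have p: "0 < 1 + m\<^sup>2" by (simp add: add_pos_nonneg)
  have "t * m \<le> (1 + m) * m" using m by (intro mult_right_mono) auto
  also have "\<dots> \<le> 2 * (1 + m\<^sup>2)"
  proof -
    have "0 \<le> (m - 1)\<^sup>2 + 1 + m" using m by simp
    then show ?thesis by (simp add: power2_eq_square algebra_simps)
  qed
  finally have "4 * (t * m) \<le> 8 * (1 + m\<^sup>2)" by simp
  then have "4 * (t * m) / (1 + m\<^sup>2)\<^sup>2 \<le> 8 * (1 + m\<^sup>2) / (1 + m\<^sup>2)\<^sup>2"
    by (intro divide_right_mono) auto
  also have "\<dots> = 8 / (1 + m\<^sup>2)"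
  proof -
    have "8 * d / d\<^sup>2 = 8 / d" if "0 < d" for d :: real
      using that by (simp add: power2_eq_square)
    from this[OF p] show ?thesis .
  qed
  finally show ?thesis
    using assms m(1) p by (simp add: smooth_step'_def flip: m_def)
qed

lemma smooth_step_tendsto:
  assumes "s > 0"
  shows "(\<lambda>k. smooth_step (s * (real k + 1))) \<longlonglongrightarrow> 1"
    and "(\<lambda>k. 2 * (s * (real k + 1)) * smooth_step' (s * (real k + 1))) \<longlonglongrightarrow> 0"
proof -
  have "filterlim (\<lambda>k. s * (real k + 1)) at_top sequentially"
    using assms by real_asymp
  moreover have "((\<lambda>t. 1 / (1 + (max 0 (t - 1))\<^sup>2)) \<longlongrightarrow> (0::real)) at_top"
  proof (rule Lim_transform_eventually)
    show "((\<lambda>t. 1 / (1 + (t - 1)\<^sup>2)) \<longlongrightarrow> (0::real)) at_top" by real_asymp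
    show "\<forall>\<^sub>F t in at_top. 1 / (1 + (t - 1)\<^sup>2) = 1 / (1 + (max 0 (t - 1::real))\<^sup>2)"
      using eventually_ge_at_top[of 1] by eventually_elim simp
  qed
  ultimately have *: "(\<lambda>k. 1 / (1 + (max 0 (s * (real k + 1) - 1))\<^sup>2)) \<longlonglongrightarrow> 0"
    by (rule filterlim_compose[rotated])
  show "(\<lambda>k. smooth_step (s * (real k + 1))) \<longlonglongrightarrow> 1"
    unfolding smooth_step_def using tendsto_diff[OF tendsto_const[of 1] *] by simp
  show "(\<lambda>k. 2 * (s * (real k + 1)) * smooth_step' (s * (real k + 1))) \<longlonglongrightarrow> 0"
  proof (rule Lim_null_comparison)
    show "\<forall>\<^sub>F k in sequentially. norm (2 * (s * (real k + 1)) * smooth_step' (s * (real k + 1)))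
        \<le> 8 * (1 / (1 + (max 0 (s * (real k + 1) - 1))\<^sup>2))"
      using smooth_step'_dilation_bound[of "s * (real _ + 1)"] assms by (auto intro!: always_eventually)
    show "(\<lambda>k. 8 * (1 / (1 + (max 0 (s * (real k + 1) - 1))\<^sup>2))) \<longlonglongrightarrow> 0"
      using tendsto_mult[OF tendsto_const[of 8] *] by simp
  qed
qed

lemma
  assumes "\<phi> \<in> C1_c \<Omega>"
  shows C1_c_has_derivative: "(\<phi> has_derivative (\<lambda>h. grad \<phi> x \<bullet> h)) (at x)"
    and C1_c_continuous_grad: "continuous_on UNIV (grad \<phi>)"
    and C1_c_support: "closure {x. \<phi> x \<noteq> 0} \<subseteq> \<Omega>"
    and C1_c_compact_support: "compact (closure {x. \<phi> x \<noteq> 0})"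
    and C1_c_continuous: "continuous_on UNIV \<phi>"
proof -
  have D: "(\<phi> has_derivative frechet_derivative \<phi> (at x)) (at x)" for x
  proof -
    have "\<phi> differentiable (at x)" using assms unfolding C1_c_def by blast
    then show ?thesis by (simp only: frechet_derivative_works)
  qed
  have "grad \<phi> x \<bullet> h = frechet_derivative \<phi> (at x) h" for h x
  proof -
    have l: "linear (frechet_derivative \<phi> (at x))" using D by (rule has_derivative_linear)
    have "frechet_derivative \<phi> (at x) h = frechet_derivative \<phi> (at x) (\<Sum>i\<in>UNIV. h $ i *\<^sub>R axis i 1)"
      by (simp add: basis_expansion flip: scalar_mult_eq_scaleR)
    also have "\<dots> = (\<Sum>i\<in>UNIV. h $ i * frechet_derivative \<phi> (at x) (axis i 1))"
      by (simp add: linear_sum[OF l] linear_cmul[OF l])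
    finally show ?thesis by (simp add: grad_def inner_vec_def mult.commute)
  qed
  with D show "(\<phi> has_derivative (\<lambda>h. grad \<phi> x \<bullet> h)) (at x)" by simp
  show "continuous_on UNIV \<phi>"
    using D by (meson continuous_at_imp_continuous_on has_derivative_continuous)
qed (use assms in \<open>auto simp: C1_c_def\<close>)

lemma grad_unique:
  fixes \<phi> :: "real^'n \<Rightarrow> real"
  assumes "(\<phi> has_derivative (\<lambda>h. v \<bullet> h)) (at x)"
  shows "grad \<phi> x = v"
proof -
  have "frechet_derivative \<phi> (at x) = (\<lambda>h. v \<bullet> h)"
    using frechet_derivative_at[OF assms] by simp
  then show ?thesis by (simp add: grad_def vec_eq_iff inner_axis)
qed

lemma C1_c_outside_support:
  assumes "x \<notin> closure {x. \<phi> x \<noteq> 0}"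
  shows "\<phi> x = 0" and "grad \<phi> x = 0"
proof -
  have *: "\<phi> y = 0" if "y \<notin> closure {x. \<phi> x \<noteq> 0}" for y
    using that closure_subset[of "{x. \<phi> x \<noteq> 0}"] by blast
  then show "\<phi> x = 0" using assms by blast
  have "(\<phi> has_derivative (\<lambda>h. 0)) (at x)"
  proof (rule has_derivative_transform_within_open[OF has_derivative_const])
    show "open (- closure {x. \<phi> x \<noteq> 0})" by (rule open_Compl[OF closed_closure])
    show "x \<in> - closure {x. \<phi> x \<noteq> 0}" using assms by simp
    show "0 = \<phi> y" if "y \<in> - closure {x. \<phi> x \<noteq> 0}" for y
      using *[of y] that by simp
  qed
  then show "grad \<phi> x = 0" by (intro grad_unique) simp
qed

text \<open>The gradient is bounded because it is continuous and vanishes off a compact set; the Lipschitz bound is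
the mean value inequality.\<close>

lemma C1_c_bounds:
  assumes "\<phi> \<in> C1_c \<Omega>"
  obtains C where "0 \<le> C" "\<And>x. \<bar>\<phi> x\<bar> \<le> C" "\<And>x. norm (grad \<phi> x) \<le> C"
    "\<And>x y. \<bar>\<phi> x - \<phi> y\<bar> \<le> C * norm (x - y)"
proof -
  let ?S = "closure {x. \<phi> x \<noteq> 0}"
  have "bounded (\<phi> ` ?S)" "bounded (grad \<phi> ` ?S)"
    using compact_imp_bounded[OF compact_continuous_image[OF continuous_on_subset[OF _ subset_UNIV]
        C1_c_compact_support[OF assms]]]
      C1_c_continuous[OF assms] C1_c_continuous_grad[OF assms] by blast+
  then obtain C1 C2 where C: "\<And>x. x \<in> ?S \<Longrightarrow> \<bar>\<phi> x\<bar> \<le> C1" "\<And>x. x \<in> ?S \<Longrightarrow> norm (grad \<phi> x) \<le> C2"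
    unfolding bounded_iff by (metis image_eqI real_norm_def)
  define C where "C = max 0 (max C1 C2)"
  have b: "\<bar>\<phi> x\<bar> \<le> C \<and> norm (grad \<phi> x) \<le> C" for x
  proof (cases "x \<in> ?S")
    case True
    from C[OF this] show ?thesis by (simp add: C_def le_max_iff_disj)
  next
    case False
    from C1_c_outside_support[OF this] show ?thesis by (simp add: C_def)
  qed
  have "norm (\<phi> x - \<phi> y) \<le> C * norm (x - y)" for x y
  proof (rule differentiable_bound[of UNIV])
    show "(\<phi> has_derivative (\<lambda>h. grad \<phi> x \<bullet> h)) (at x within UNIV)" for x
      using C1_c_has_derivative[OF assms] by simp
    show "onorm ((\<bullet>) (grad \<phi> x)) \<le> C" for x
    proof (rule onorm_le)
      fix h
      have "norm (grad \<phi> x \<bullet> h) \<le> norm (grad \<phi> x) * norm h"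
        by (simp add: Cauchy_Schwarz_ineq2)
      also have "\<dots> \<le> C * norm h" using b[of x] by (intro mult_right_mono) auto
      finally show "norm (grad \<phi> x \<bullet> h) \<le> C * norm h" .
    qed
  qed auto
  then have "\<bar>\<phi> x - \<phi> y\<bar> \<le> C * norm (x - y)" for x y by simp
  moreover have "0 \<le> C" by (simp add: C_def)
  ultimately show thesis
    using that[of C] b by simp
qed

section \<open>The divergence theorem with a removable point singularity\<close>

text \<open>With the cut-off equal to 0 near the origin, the components of the product of X, \<open>\<phi>\<close> and the cut-off are
C1 functions of compact support on the whole space, so each of their partial derivatives integrates to 0;
F is the sum of these.\<close>

lemma divergence_theorem_away_from_0:
  fixes X :: "real^'n \<Rightarrow> real^'n"
  assumes \<Omega>: "open \<Omega>" and \<phi>: "\<phi> \<in> C1_c \<Omega>" and a: "0 < a"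
    and der: "\<And>x. x \<in> \<Omega> - {0} \<Longrightarrow> (X has_derivative X' x) (at x)"
    and cont: "\<And>i. continuous_on (\<Omega> - {0}) (\<lambda>x. X' x (axis i 1) $ i)"
    and div: "\<And>x. x \<in> \<Omega> - {0} \<Longrightarrow> (\<Sum>i\<in>UNIV. X' x (axis i 1) $ i) = d x"
  defines "F \<equiv> \<lambda>x. indicator \<Omega> x *\<^sub>R ((X x \<bullet> grad \<phi> x + d x * \<phi> x) * smooth_step (a * (x \<bullet> x))
      + \<phi> x * (X x \<bullet> x) * (2 * a * smooth_step' (a * (x \<bullet> x))))"
  shows "integrable lborel F" and "(LINT x|lborel. F x) = 0"
proof -
  let ?S = "closure {x. \<phi> x \<noteq> 0}"
  define \<sigma> where "\<sigma> x = smooth_step (a * (x \<bullet> x))" for x :: "real^'n"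
  define \<sigma>' where "\<sigma>' x = smooth_step' (a * (x \<bullet> x))" for x :: "real^'n"
  define G where "G i x = X x $ i * \<phi> x * \<sigma> x" for i x
  define H where "H i x h = (if x \<in> \<Omega> - {0} then
      X' x h $ i * (\<phi> x * \<sigma> x) + X x $ i * ((grad \<phi> x \<bullet> h) * \<sigma> x + \<phi> x * (2 * a * (x \<bullet> h) * \<sigma>' x))
    else 0)" for i x h
  define U where "U = {x :: real^'n. a * (x \<bullet> x) < 1}"
  have U: "open U" unfolding U_def by (intro open_Collect_less continuous_intros)
  have S: "open (- ?S)" by (rule open_Compl[OF closed_closure])
  have \<Omega>0: "open (\<Omega> - {0})" using \<Omega> by (simp add: open_delete)
  \<comment> \<open>On the last two sets all products vanish, so differentiability matters only on the first one.\<close>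
  have cover: "UNIV = (\<Omega> - {0}) \<union> - ?S \<union> U"
    using C1_c_support[OF \<phi>] by (auto simp: U_def)
  have zS: "G i x = 0" "H i x h = 0" if "x \<notin> ?S" for i x h
    using C1_c_outside_support[OF that] by (simp_all add: G_def H_def)
  have zU: "G i x = 0" "H i x h = 0" if "x \<in> U" for i x h
    using that by (simp_all add: G_def H_def U_def \<sigma>_def \<sigma>'_def smooth_step_eq_0)
  have der_\<sigma>: "(\<sigma> has_derivative (\<lambda>h. 2 * a * (x \<bullet> h) * \<sigma>' x)) (at x)" for x
  proof -
    have "((\<lambda>x. a * (x \<bullet> x)) has_derivative (\<lambda>h. 2 * a * (x \<bullet> h))) (at x)"
      by (auto intro!: derivative_eq_intros simp: inner_commute)
    from DERIV_compose_FDERIV[OF has_real_derivative_smooth_step this] show ?thesis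
      by (simp add: \<sigma>_def[abs_def] \<sigma>'_def)
  qed
  have derG: "(G i has_derivative H i x) (at x)" for i x
  proof -
    have "x \<in> (\<Omega> - {0}) \<union> - ?S \<union> U" using cover by auto
    then consider "x \<in> \<Omega> - {0}" | "x \<in> - ?S" | "x \<in> U" by blast
    then show ?thesis
    proof cases
      case 1
      have "((\<lambda>x. X x $ i) has_derivative (\<lambda>h. X' x h $ i)) (at x)"
        by (rule bounded_linear.has_derivative[OF bounded_linear_vec_nth der[OF 1]])
      from has_derivative_mult[OF this has_derivative_mult[OF C1_c_has_derivative[OF \<phi>] der_\<sigma>]]
      have "((\<lambda>x. X x $ i * (\<phi> x * \<sigma> x)) has_derivative H i x) (at x)"
        by (rule has_derivative_eq_rhs) (use 1 in \<open>simp add: H_def fun_eq_iff algebra_simps\<close>)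
      then show ?thesis by (simp add: G_def[abs_def] mult.assoc)
    next
      case 2
      have "((\<lambda>x. 0) has_derivative (\<lambda>h. 0)) (at x)" by simp
      then have "(G i has_derivative (\<lambda>h. 0)) (at x)"
        by (rule has_derivative_transform_within_open[OF _ S 2]) (use zS(1) in simp)
      moreover have "H i x = (\<lambda>h. 0)" using 2 zS(2) by blast
      ultimately show ?thesis by simp
    next
      case 3
      have "((\<lambda>x. 0) has_derivative (\<lambda>h. 0)) (at x)" by simp
      then have "(G i has_derivative (\<lambda>h. 0)) (at x)"
        by (rule has_derivative_transform_within_open[OF _ U 3]) (use zU(1) in simp)
      moreover have "H i x = (\<lambda>h. 0)" using 3 zU(2) by blast
      ultimately show ?thesis by simp
    qed
  qed
  have cX: "continuous_on (\<Omega> - {0}) X"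
    using der has_derivative_continuous continuous_at_imp_continuous_on by blast
  have contH: "continuous_on UNIV (\<lambda>x. H i x (axis i 1))" for i
    unfolding cover
  proof (intro continuous_on_open_Un \<Omega>0 S U open_Un)
    have "continuous_on (\<Omega> - {0}) (\<lambda>x. X' x (axis i 1) $ i * (\<phi> x * \<sigma> x)
        + X x $ i * ((grad \<phi> x \<bullet> axis i 1) * \<sigma> x + \<phi> x * (2 * a * (x \<bullet> axis i 1) * \<sigma>' x)))"
      unfolding \<sigma>_def \<sigma>'_def
      by (intro continuous_intros cont cX continuous_on_subset[OF C1_c_continuous[OF \<phi>]]
          continuous_on_subset[OF C1_c_continuous_grad[OF \<phi>]] subset_UNIV)
    then show "continuous_on (\<Omega> - {0}) (\<lambda>x. H i x (axis i 1))"
      by (rule continuous_on_eq) (simp add: H_def)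
    show "continuous_on (- ?S) (\<lambda>x. H i x (axis i 1))"
      by (rule continuous_on_eq[OF continuous_on_const[of _ 0]]) (use zS(2) in simp)
    show "continuous_on U (\<lambda>x. H i x (axis i 1))"
      by (rule continuous_on_eq[OF continuous_on_const[of _ 0]]) (use zU(2) in simp)
  qed
  obtain R where "?S \<subseteq> ball 0 R"
    using compact_imp_bounded[OF C1_c_compact_support[OF \<phi>]] bounded_subset_ballD by blast
  then have supp: "G i x = 0" if "R \<le> norm x" for i x
  proof -
    have "x \<notin> ball 0 R" using that by simp
    then have "x \<notin> ?S" using \<open>?S \<subseteq> ball 0 R\<close> by blast
    then show ?thesis by (rule zS(1))
  qed
  note int = integral_directional_derivative_eq_0[OF derG contH supp]
  have F: "F x = (\<Sum>i\<in>UNIV. H i x (axis i 1))" for x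
  proof (cases "x \<in> \<Omega> - {0}")
    case True
    have "(\<Sum>i\<in>UNIV. H i x (axis i 1)) = (\<Sum>i\<in>UNIV. X' x (axis i 1) $ i) * (\<phi> x * \<sigma> x)
        + (\<Sum>i\<in>UNIV. X x $ i * grad \<phi> x $ i) * \<sigma> x
        + (\<Sum>i\<in>UNIV. X x $ i * x $ i) * (2 * a * \<phi> x * \<sigma>' x)"
      using True unfolding sum_distrib_right sum.distrib[symmetric]
      by (intro sum.cong) (simp_all add: H_def inner_axis algebra_simps)
    then show ?thesis
      using True div[OF True] by (simp add: F_def \<sigma>_def \<sigma>'_def inner_vec_def algebra_simps)
  next
    case False
    then have "F x = 0" by (auto simp: F_def smooth_step_eq_0)
    moreover have "H i x h = 0" for i h using False by (simp only: H_def if_False)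
    ultimately show ?thesis by simp
  qed
  show "integrable lborel F" "(LINT x|lborel. F x) = 0"
    unfolding F[abs_def] using int by simp_all
qed

text \<open>The point singularity of X carries no mass of the distributional divergence. Removing the cut-off
leaves an error term that contains \<open>\<phi> (X \<bullet> x) / (x \<bullet> x)\<close> times a bounded factor tending to 0, so dominated
convergence applies as soon as this function is integrable. For a field as singular as |x|^(-N) it is
integrable only after subtraction of a constant c from \<open>\<phi>\<close>; if X is even, the subtracted part is odd because
the cut-off is radial, and its integral is 0.\<close>

lemma divergence_theorem_removable_origin:
  fixes X :: "real^'n \<Rightarrow> real^'n"
  assumes \<Omega>: "open \<Omega>" and \<phi>: "\<phi> \<in> C1_c \<Omega>"
    and [measurable]: "X \<in> borel_measurable borel" "d \<in> borel_measurable borel"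
    and der: "\<And>x. x \<in> \<Omega> - {0} \<Longrightarrow> (X has_derivative X' x) (at x)"
    and cont: "\<And>i. continuous_on (\<Omega> - {0}) (\<lambda>x. X' x (axis i 1) $ i)"
    and div: "\<And>x. x \<in> \<Omega> - {0} \<Longrightarrow> (\<Sum>i\<in>UNIV. X' x (axis i 1) $ i) = d x"
    and int1: "set_integrable lborel \<Omega> (\<lambda>x. X x \<bullet> grad \<phi> x + d x * \<phi> x)"
    and int2: "set_integrable lborel \<Omega> (\<lambda>x. (\<phi> x - c) * (X x \<bullet> x) / (x \<bullet> x))"
    and even: "c = 0 \<or> (\<forall>x. (x \<in> \<Omega> \<longleftrightarrow> - x \<in> \<Omega>) \<and> X (- x) = X x)"
  shows "(LINT x:\<Omega>|lborel. X x \<bullet> grad \<phi> x + d x * \<phi> x) = 0"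
proof -
  define p where "p x = indicator \<Omega> x *\<^sub>R (X x \<bullet> grad \<phi> x + d x * \<phi> x)" for x
  define q where "q x = indicator \<Omega> x *\<^sub>R ((\<phi> x - c) * (X x \<bullet> x) / (x \<bullet> x))" for x
  define s where "s k x = smooth_step (x \<bullet> x * (real k + 1))" for k and x :: "real^'n"
  define w where "w k x = 2 * (x \<bullet> x * (real k + 1)) * smooth_step' (x \<bullet> x * (real k + 1))"
    for k and x :: "real^'n"
  define odd_rest where "odd_rest k x = indicator \<Omega> x *\<^sub>R (c * (X x \<bullet> x) * (2 * (real k + 1) *
      smooth_step' ((real k + 1) * (x \<bullet> x))))" for k x
  have [measurable]: "\<Omega> \<in> sets borel" using \<Omega> by simp
  have [measurable]: "\<phi> \<in> borel_measurable borel" "grad \<phi> \<in> borel_measurable borel"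
    using C1_c_continuous[OF \<phi>] C1_c_continuous_grad[OF \<phi>]
    by (auto intro: borel_measurable_continuous_onI)
  have [measurable]: "smooth_step \<in> borel_measurable borel" "smooth_step' \<in> borel_measurable borel"
    by (auto intro!: borel_measurable_continuous_onI continuous_on_smooth_step[OF continuous_on_id, simplified])
  have p: "integrable lborel p" and q: "integrable lborel q"
    using int1 int2 by (simp_all add: p_def[abs_def] q_def[abs_def] set_integrable_def)
  have wb: "\<bar>w k x\<bar> \<le> 8" for k x
  proof -
    have "\<bar>w k x\<bar> \<le> 8 / (1 + (max 0 (x \<bullet> x * (real k + 1) - 1))\<^sup>2)"
      unfolding w_def by (rule smooth_step'_dilation_bound) simp
    also have "\<dots> \<le> 8 / 1" by (rule divide_left_mono) (auto simp: add_pos_nonneg)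
    finally show ?thesis by simp
  qed
  have sb: "\<bar>s k x\<bar> \<le> 1" for k x using smooth_step_bounds by (simp add: s_def)
  have [measurable]: "s k \<in> borel_measurable borel" "w k \<in> borel_measurable borel"
      "odd_rest k \<in> borel_measurable borel" for k
    unfolding s_def[abs_def] w_def[abs_def] odd_rest_def[abs_def] by measurable
  have ps: "integrable lborel (\<lambda>x. p x * s k x)" for k
    by (rule Bochner_Integration.integrable_bound[OF p])
      (use p sb in \<open>auto simp: abs_mult mult_left_le\<close>)
  have qw: "integrable lborel (\<lambda>x. q x * w k x)" for k
    by (rule Bochner_Integration.integrable_bound[OF integrable_mult_right[OF q, of 8]])
      (use q wb in \<open>auto simp: abs_mult mult.commute[of 8] intro!: mult_left_mono\<close>)
  \<comment> \<open>The smooth step at the scale a = k + 1; the product rule term is divided between q and the odd part.\<close>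
  have split: "indicator \<Omega> x *\<^sub>R ((X x \<bullet> grad \<phi> x + d x * \<phi> x) * smooth_step ((real k + 1) * (x \<bullet> x))
      + \<phi> x * (X x \<bullet> x) * (2 * (real k + 1) * smooth_step' ((real k + 1) * (x \<bullet> x))))
      = p x * s k x + q x * w k x + odd_rest k x" for k x
  proof (cases "x = 0")
    case True
    then show ?thesis by (simp add: p_def q_def s_def w_def odd_rest_def smooth_step_eq_0)
  next
    case False
    then have "q x * w k x = indicator \<Omega> x *\<^sub>R ((\<phi> x - c) * (X x \<bullet> x) *
        (2 * (real k + 1) * smooth_step' ((real k + 1) * (x \<bullet> x))))"
      by (simp add: q_def w_def mult.commute[of "x \<bullet> x"])
    then show ?thesis
      by (simp add: p_def s_def odd_rest_def mult.commute[of "x \<bullet> x"] left_diff_distrib distrib_left)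
        (simp add: algebra_simps)
  qed
  have odd_rest_0: "(LINT x|lborel. odd_rest k x) = 0" for k
  proof (cases "c = 0")
    case True
    then show ?thesis by (simp add: odd_rest_def)
  next
    case False
    then have "x \<in> \<Omega> \<longleftrightarrow> - x \<in> \<Omega>" "X (- x) = X x" for x using even by auto
    then have "odd_rest k (- x) = - odd_rest k x" for x
      by (simp add: odd_rest_def indicator_def)
    then show ?thesis by (intro lborel_integral_odd) auto
  qed
  have zero: "(LINT x|lborel. p x * s k x + q x * w k x) = 0" for k
  proof -
    have *: "integrable lborel (\<lambda>x. p x * s k x + q x * w k x + odd_rest k x)"
      "(LINT x|lborel. p x * s k x + q x * w k x + odd_rest k x) = 0"
      using divergence_theorem_away_from_0[OF \<Omega> \<phi> _ der cont div, of "real k + 1"]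
      unfolding split by auto
    have pq: "integrable lborel (\<lambda>x. p x * s k x + q x * w k x)" using ps qw by simp
    have "integrable lborel (\<lambda>x. p x * s k x + q x * w k x + odd_rest k x - (p x * s k x + q x * w k x))"
      by (rule Bochner_Integration.integrable_diff[OF *(1) pq])
    then have "integrable lborel (odd_rest k)" by simp
    from Bochner_Integration.integral_add[OF pq this] *(2) odd_rest_0 show ?thesis by simp
  qed
  have "(\<lambda>k. LINT x|lborel. p x * s k x + q x * w k x) \<longlonglongrightarrow> (LINT x|lborel. p x)"
  proof (rule integral_dominated_convergence[where w = "\<lambda>x. \<bar>p x\<bar> + 8 * \<bar>q x\<bar>"])
    show "integrable lborel (\<lambda>x. \<bar>p x\<bar> + 8 * \<bar>q x\<bar>)" using p q by auto
    show "AE x in lborel. norm (p x * s k x + q x * w k x) \<le> \<bar>p x\<bar> + 8 * \<bar>q x\<bar>" for k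
    proof (rule AE_I2)
      fix x
      have "\<bar>p x * s k x\<bar> \<le> \<bar>p x\<bar> * 1" "\<bar>q x * w k x\<bar> \<le> \<bar>q x\<bar> * 8"
        unfolding abs_mult using sb wb by (intro mult_left_mono; simp)+
      then show "norm (p x * s k x + q x * w k x) \<le> \<bar>p x\<bar> + 8 * \<bar>q x\<bar>" by simp
    qed
    have "(\<lambda>k. p x * s k x + q x * w k x) \<longlonglongrightarrow> p x" if "x \<noteq> 0" for x
    proof -
      have "(\<lambda>k. p x * s k x + q x * w k x) \<longlonglongrightarrow> p x * 1 + q x * 0"
        unfolding s_def w_def using that by (intro tendsto_intros smooth_step_tendsto) auto
      then show ?thesis by simp
    qed
    then show "AE x in lborel. (\<lambda>k. p x * s k x + q x * w k x) \<longlonglongrightarrow> p x"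
      using AE_lborel_singleton[of 0] by (auto elim!: eventually_mono)
  qed (use p q in auto)
  then have "(LINT x|lborel. p x) = 0" by (simp add: zero LIMSEQ_const_iff)
  then show ?thesis by (simp add: set_lebesgue_integral_def p_def)
qed

section \<open>The radial profile\<close>

text \<open>With s = |x|^2 this is the reciprocal logarithm that damps the singularity. The summand 16 keeps the
values at most 1/16 on the unit ball, which bounds the anisotropy of the coefficients by 1/2. The value 0
at 0 is the limit there.\<close>

definition invlog :: "real \<Rightarrow> real" where
  "invlog s = (if s \<le> 0 then 0 else 1 / (16 - ln s))"

text \<open>As a function of x, with s = |x|^2, this is |x|^(-N) / (16 - 2 ln |x|)^2.\<close>

definition profile :: "real \<Rightarrow> real \<Rightarrow> real" where
  "profile N s = s powr (- N / 2) * (invlog s)\<^sup>2"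

lemma invlog_bounds:
  assumes "s < 1"
  shows "0 \<le> invlog s" "invlog s \<le> 1 / 16"
proof -
  have "0 \<le> invlog s \<and> invlog s \<le> 1 / 16"
  proof (cases "s \<le> 0")
    case False
    then have "ln s < 0" using assms by simp
    then have "16 \<le> 16 - ln s" by linarith
    then have "1 / (16 - ln s) \<le> 1 / 16" "0 \<le> 1 / (16 - ln s)"
      by (auto intro!: divide_left_mono)
    then show ?thesis using False by (simp only: invlog_def if_False)
  qed (simp add: invlog_def)
  then show "0 \<le> invlog s" "invlog s \<le> 1 / 16" by simp_all
qed

lemma profile_nonneg: "0 \<le> profile N s"
  by (simp add: profile_def)

lemma borel_measurable_invlog [measurable]: "invlog \<in> borel_measurable borel"
  unfolding invlog_def[abs_def] by measurable

lemma borel_measurable_profile [measurable]: "profile N \<in> borel_measurable borel"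
  unfolding profile_def[abs_def] by measurable

lemma has_real_derivative_invlog:
  assumes "0 < s" "s < 1"
  shows "(invlog has_real_derivative (invlog s)\<^sup>2 / s) (at s)"
proof -
  have "ln s < 0" using assms by simp
  then have "16 - ln s \<noteq> 0" by linarith
  then have "((\<lambda>s. 1 / (16 - ln s)) has_real_derivative (1 / (16 - ln s))\<^sup>2 / s) (at s)"
    using assms by (auto intro!: derivative_eq_intros simp: power2_eq_square divide_simps)
  moreover have "(invlog s)\<^sup>2 = (1 / (16 - ln s))\<^sup>2" using assms by (simp add: invlog_def)
  ultimately show ?thesis
    by (simp only:) (rule has_field_derivative_transform_within_open[where S = "{0<..}"],
        use assms in \<open>auto simp: invlog_def\<close>)
qed

text \<open>Every radial coefficient below is a power of s times a polynomial in z = invlog s. Since z has the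
derivative z^2/s, this class is closed under differentiation, and differential equations for such
coefficients become polynomial identities in z.\<close>

lemma has_real_derivative_powr_invlog:
  assumes "0 < s" "s < 1" and q: "(q has_real_derivative q') (at (invlog s))"
  shows "((\<lambda>s. s powr a * q (invlog s)) has_real_derivative
    s powr (a - 1) * (a * q (invlog s) + (invlog s)\<^sup>2 * q')) (at s)"
proof -
  have 1: "((\<lambda>s. q (invlog s)) has_real_derivative q' * ((invlog s)\<^sup>2 / s)) (at s)"
    by (rule DERIV_chain2[OF q has_real_derivative_invlog[OF assms(1,2)]])
  have 2: "((\<lambda>s. s powr a) has_real_derivative a * s powr (a - 1)) (at s)"
    using assms by (intro has_real_derivative_powr) auto
  have 3: "s powr a = s * s powr (a - 1)" using assms by (simp add: powr_mult_base)
  have "a * s powr (a - 1) * q (invlog s) + q' * ((invlog s)\<^sup>2 / s) * s powr a =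
      s powr (a - 1) * (a * q (invlog s) + (invlog s)\<^sup>2 * q')"
    unfolding 3 using assms by (simp add: algebra_simps)
  with DERIV_mult[OF 2 1] show ?thesis by (simp add: algebra_simps)
qed

lemma isCont_invlog:
  assumes "s < 1"
  shows "isCont invlog s"
proof -
  consider "s < 0" | "s = 0" | "0 < s" by linarith
  then show ?thesis
  proof cases
    case 1
    have "isCont (\<lambda>_. 0 :: real) s" by simp
    moreover have "\<forall>\<^sub>F x in nhds s. invlog x = 0"
      using eventually_nhds_in_open[of "{..<0}" s] 1
      by (auto elim!: eventually_mono simp: invlog_def)
    ultimately show ?thesis using isCont_cong by fastforce
  next
    case 2
    have "((\<lambda>s. 1 / (16 - ln s)) \<longlongrightarrow> (0::real)) (at_right 0)" by real_asymp
    moreover have "\<forall>\<^sub>F s::real in at_right 0. 1 / (16 - ln s) = invlog s"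
      using eventually_at_right_less[of 0] by eventually_elim (simp add: invlog_def)
    ultimately have "(invlog \<longlongrightarrow> 0) (at_right 0)"
      by (rule Lim_transform_eventually)
    moreover have "(invlog \<longlongrightarrow> 0) (at_left 0)"
    proof (rule Lim_transform_eventually[OF tendsto_const])
      show "\<forall>\<^sub>F s in at_left 0. 0 = invlog s"
        by (auto simp: eventually_at_left_field invlog_def intro: exI[of _ "-1"])
    qed
    ultimately show ?thesis
      using 2 by (simp add: isCont_def invlog_def filterlim_split_at)
  next
    case 3
    then show ?thesis using has_real_derivative_invlog assms DERIV_isCont by blast
  qed
qed

text \<open>On the dyadic shell between the radii 2^(-k-1) and 2^(-k) the profile is at most a constant multiple of
2^(kn) / (k+1)^2, and the shell has volume at most a constant multiple of 2^(-kn). So the integral is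
bounded by the convergent series of 1/(k+1)^2.\<close>

lemma set_integrable_profile:
  "set_integrable lborel (ball 0 1) (\<lambda>x :: 'a::euclidean_space. profile (DIM('a)) (x \<bullet> x))"
proof -
  let ?n = "DIM('a)"
  define a :: "nat \<Rightarrow> real" where "a k = 2 ^ (Suc k * ?n) / (real (Suc k))\<^sup>2" for k
  define B :: "nat \<Rightarrow> 'a set" where "B k = ball 0 ((1/2) ^ k)" for k
  have [measurable]: "B k \<in> sets borel" for k by (simp add: B_def)
  have a0: "0 \<le> a k" for k by (simp add: a_def)
  have bound: "ennreal (indicator (ball 0 1) x * profile ?n (x \<bullet> x)) \<le> (\<Sum>k. ennreal (a k) * indicator (B k) x)"
    for x :: 'a
  proof (cases "x \<in> ball 0 1 - {0}")
    case False
    then have "x \<notin> ball 0 1 \<or> x \<bullet> x = 0" by auto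
    then have "indicator (ball 0 1) x * profile ?n (x \<bullet> x) = 0"
      by (auto simp: profile_def simp del: inner_eq_zero_iff)
    then show ?thesis by (simp only: ennreal_0 zero_le)
  next
    case True
    define r where "r = norm x"
    have r: "0 < r" "r < 1" using True by (auto simp: r_def)
    obtain m where "(1/2) ^ m < r" using real_arch_pow_inv[of r "1/2"] r by auto
    then obtain j where j: "(1/2) ^ j \<le> r" "\<And>i. i < j \<Longrightarrow> \<not> (1/2) ^ i \<le> r"
      using ex_least_nat_le[of "\<lambda>j. (1/2) ^ j \<le> r" m] by auto
    have "j \<noteq> 0" using j(1) r(2) power_0[of "1/2::real"] by (metis not_le)
    then obtain k where k: "j = Suc k" using not0_implies_Suc by blast
    have rk: "r < (1/2) ^ k" using j(2)[of k] k by simp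
    have xr: "x \<bullet> x = r\<^sup>2" by (simp add: r_def power2_norm_eq_inner)
    have "(x \<bullet> x) powr (- real ?n / 2) = (r powr 2) powr (- real ?n / 2)"
      unfolding xr using r by (simp only: powr_numeral)
    also have "\<dots> = r powr - real ?n"
      by (simp add: powr_powr)
    also have "\<dots> = 1 / r ^ ?n"
      using r by (simp only: powr_minus_divide powr_realpow)
    also have "\<dots> \<le> 1 / ((1/2) ^ j) ^ ?n"
      using j(1) r by (intro divide_left_mono power_mono) auto
    also have "\<dots> = 2 ^ (Suc k * ?n)" by (simp add: k power_one_over power_mult[symmetric] del: power_Suc)
    finally have p: "(x \<bullet> x) powr (- real ?n / 2) \<le> 2 ^ (Suc k * ?n)" .
    have "ln r \<le> ln ((1/2) ^ k)" using rk r by simp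
    also have "\<dots> = - real k * ln 2" by (simp add: ln_realpow ln_div)
    finally have "ln r \<le> - real k * ln 2" .
    moreover have "real k * 1 \<le> real k * (2 * ln 2)" using ln2_ge_two_thirds by (intro mult_left_mono) auto
    ultimately have "real (Suc k) \<le> 16 - 2 * ln r" by simp
    moreover have "invlog (x \<bullet> x) = 1 / (16 - 2 * ln r)"
    proof -
      have "0 < r\<^sup>2" "ln (r\<^sup>2) = 2 * ln r" using r by (simp_all add: ln_realpow)
      then show ?thesis by (simp only: invlog_def xr not_le[symmetric] if_False)
    qed
    ultimately have "0 \<le> invlog (x \<bullet> x)" "invlog (x \<bullet> x) \<le> 1 / real (Suc k)"
      by (auto intro!: divide_left_mono)
    then have "(invlog (x \<bullet> x))\<^sup>2 \<le> (1 / real (Suc k))\<^sup>2" by (intro power_mono) auto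
    then have "profile ?n (x \<bullet> x) \<le> 2 ^ (Suc k * ?n) * (1 / real (Suc k))\<^sup>2"
      unfolding profile_def using p by (intro mult_mono) auto
    also have "\<dots> = a k" by (simp add: a_def power_divide)
    finally have "ennreal (indicator (ball 0 1) x * profile ?n (x \<bullet> x)) \<le> ennreal (a k) * indicator (B k) x"
      using True rk by (simp add: B_def r_def ennreal_leI)
    also have "\<dots> \<le> (\<Sum>k. ennreal (a k) * indicator (B k) x)"
    proof -
      have "f k \<le> suminf f" for f :: "nat \<Rightarrow> ennreal"
        using sum_le_suminf[of f "{k}"] by simp
      then show ?thesis .
    qed
    finally show ?thesis .
  qed
  have "(\<integral>\<^sup>+x. ennreal (indicator (ball 0 1) x * profile ?n (x \<bullet> x)) \<partial>(lborel :: 'a measure))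
      \<le> (\<integral>\<^sup>+x. (\<Sum>k. ennreal (a k) * indicator (B k) x) \<partial>lborel)"
    by (rule nn_integral_mono) (rule bound)
  also have "\<dots> = (\<Sum>k. ennreal (a k) * emeasure lborel (B k))"
    by (subst nn_integral_suminf) (auto simp: nn_integral_cmult_indicator)
  also have "\<dots> = (\<Sum>k. ennreal (2 ^ ?n * unit_ball_vol ?n * (1 / (real (Suc k))\<^sup>2)))"
  proof (rule arg_cong[where f = suminf], rule ext)
    fix k
    have "a k * (unit_ball_vol ?n * ((1/2) ^ k) ^ ?n) = 2 ^ ?n * unit_ball_vol ?n * (1 / (real (Suc k))\<^sup>2)"
    proof -
      have "(2::real) ^ (Suc k * ?n) * ((1/2) ^ k) ^ ?n = (2 ^ Suc k * (1/2) ^ k) ^ ?n"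
        by (simp only: power_mult power_mult_distrib)
      also have "(2::real) ^ Suc k * (1/2) ^ k = 2"
        by (simp add: power_one_over)
      finally show ?thesis by (simp add: a_def mult_ac del: of_nat_Suc)
    qed
    then show "ennreal (a k) * emeasure lborel (B k)
        = ennreal (2 ^ ?n * unit_ball_vol ?n * (1 / (real (Suc k))\<^sup>2))"
      using a0 by (simp add: B_def emeasure_ball ennreal_mult[symmetric] del: of_nat_Suc)
  qed
  also have "\<dots> < \<infinity>"
  proof -
    have "summable (\<lambda>k. 1 / (real (Suc k))\<^sup>2)"
    proof -
      have "summable (\<lambda>k. inverse ((real k)\<^sup>2))"
        by (rule inverse_power_summable) simp
      then have "summable (\<lambda>k. inverse ((real (Suc k))\<^sup>2))"
        by (simp only: summable_Suc_iff[of "\<lambda>k. inverse ((real k)\<^sup>2)"])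
      then show ?thesis by (simp only: inverse_eq_divide)
    qed
    then have "summable (\<lambda>k. 2 ^ ?n * unit_ball_vol ?n * (1 / (real (Suc k))\<^sup>2))"
      by (rule summable_mult)
    then have "(\<Sum>k. ennreal (2 ^ ?n * unit_ball_vol ?n * (1 / (real (Suc k))\<^sup>2))) \<noteq> top"
      by (rule ennreal_suminf_neq_top) simp
    then show ?thesis by (simp only: infinity_ennreal_def less_top)
  qed
  finally have "(\<integral>\<^sup>+x. ennreal (indicator (ball 0 1) x * profile ?n (x \<bullet> x)) \<partial>(lborel :: 'a measure)) < \<infinity>" .
  moreover have "(\<lambda>x :: 'a. indicator (ball 0 1) x * profile ?n (x \<bullet> x)) \<in> borel_measurable lborel"
  proof -
    have "(\<lambda>x :: 'a. profile ?n (x \<bullet> x)) \<in> borel_measurable borel"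
      by (rule measurable_compose[OF _ borel_measurable_profile]) measurable
    moreover have "(indicator (ball 0 1) :: 'a \<Rightarrow> real) \<in> borel_measurable borel"
      by (rule borel_measurable_indicator) simp
    ultimately show ?thesis by (simp add: borel_measurable_times)
  qed
  ultimately have "integrable lborel (\<lambda>x :: 'a. indicator (ball 0 1) x * profile ?n (x \<bullet> x))"
    by (intro integrableI_nonneg) (auto simp: profile_nonneg)
  then show ?thesis by (simp add: set_integrable_def)
qed

section \<open>The dipole and its flux\<close>

lemma unit_ball_inner_self:
  fixes x :: "'a::real_inner"
  assumes "x \<in> ball 0 1 - {0}"
  shows "0 < x \<bullet> x" "x \<bullet> x < 1"
proof -
  show "0 < x \<bullet> x" using assms by simp
  have "norm x < 1" using assms by simp
  then have "(norm x)\<^sup>2 < 1\<^sup>2" by (intro power_strict_mono) auto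
  then show "x \<bullet> x < 1" by (simp add: power2_norm_eq_inner)
qed

text \<open>The fields f(|x|^2) e + h(|x|^2) x_k x, with e the k-th unit vector, contain both the gradient and the
flux of every function of the form x_k v(|x|^2).\<close>

lemma axial_field_divergence:
  fixes k :: "'n::finite"
  assumes f: "\<And>s. 0 < s \<Longrightarrow> s < 1 \<Longrightarrow> (f has_real_derivative f' s) (at s)"
    and h: "\<And>s. 0 < s \<Longrightarrow> s < 1 \<Longrightarrow> (h has_real_derivative h' s) (at s)"
    and cont: "continuous_on {0<..<1} f'" "continuous_on {0<..<1} h'"
  obtains X' :: "real^'n \<Rightarrow> real^'n \<Rightarrow> real^'n" where
    "\<And>x. x \<in> ball 0 1 - {0} \<Longrightarrow>
      ((\<lambda>x. f (x \<bullet> x) *\<^sub>R axis k 1 + (x $ k * h (x \<bullet> x)) *\<^sub>R x) has_derivative X' x) (at x)"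
    "\<And>i. continuous_on (ball 0 1 - {0}) (\<lambda>x. X' x (axis i 1) $ i)"
    "\<And>x. (\<Sum>i\<in>UNIV. X' x (axis i 1) $ i) =
      x $ k * (2 * f' (x \<bullet> x) + 2 * (x \<bullet> x) * h' (x \<bullet> x) + (real CARD('n) + 1) * h (x \<bullet> x))"
proof
  define X' :: "real^'n \<Rightarrow> real^'n \<Rightarrow> real^'n" where
    "X' x v = (2 * (x \<bullet> v) * f' (x \<bullet> x)) *\<^sub>R axis k 1
      + ((v $ k * h (x \<bullet> x) + x $ k * (2 * (x \<bullet> v) * h' (x \<bullet> x))) *\<^sub>R x + (x $ k * h (x \<bullet> x)) *\<^sub>R v)"
    for x v
  have comp: "X' x (axis i 1) $ i = axis k 1 $ i * (2 * x $ i * f' (x \<bullet> x) + h (x \<bullet> x) * x $ i)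
      + (2 * x $ k * h' (x \<bullet> x)) * (x $ i * x $ i) + x $ k * h (x \<bullet> x)" for x i
    by (simp add: X'_def inner_axis algebra_simps) (simp add: axis_def)
  have sq: "((\<lambda>x::real^'n. x \<bullet> x) has_derivative (\<lambda>v. 2 * (x \<bullet> v))) (at x)" for x
    by (auto intro!: derivative_eq_intros simp: inner_commute)
  show "((\<lambda>x. f (x \<bullet> x) *\<^sub>R axis k 1 + (x $ k * h (x \<bullet> x)) *\<^sub>R x) has_derivative X' x) (at x)"
    if "x \<in> ball 0 1 - {0}" for x
  proof -
    note s = unit_ball_inner_self[OF that]
    have F: "((\<lambda>x. f (x \<bullet> x)) has_derivative (\<lambda>v. 2 * (x \<bullet> v) * f' (x \<bullet> x))) (at x)"
      by (rule DERIV_compose_FDERIV[OF f[OF s] sq])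
    have H: "((\<lambda>x. h (x \<bullet> x)) has_derivative (\<lambda>v. 2 * (x \<bullet> v) * h' (x \<bullet> x))) (at x)"
      by (rule DERIV_compose_FDERIV[OF h[OF s] sq])
    have K: "((\<lambda>x. x $ k) has_derivative (\<lambda>v. v $ k)) (at x)"
      by (rule bounded_linear_imp_has_derivative[OF bounded_linear_vec_nth])
    show ?thesis
      by (rule has_derivative_eq_rhs[OF has_derivative_add[OF has_derivative_scaleR_left[OF F]
              has_derivative_scaleR[OF has_derivative_mult[OF K H] has_derivative_ident]]])
        (simp add: X'_def fun_eq_iff algebra_simps)
  qed
  show "continuous_on (ball 0 1 - {0}) (\<lambda>x. X' x (axis i 1) $ i)" for i
  proof -
    have sub: "(\<lambda>x::real^'n. x \<bullet> x) ` (ball 0 1 - {0}) \<subseteq> {0<..<1}"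
    proof (rule image_subsetI)
      fix x :: "real^'n"
      assume "x \<in> ball 0 1 - {0}"
      from unit_ball_inner_self[OF this] show "x \<bullet> x \<in> {0<..<1}" by simp
    qed
    have "continuous_on {0<..<1} h"
      using h by (intro continuous_at_imp_continuous_on ballI) (auto intro: DERIV_isCont)
    moreover have "continuous_on (ball 0 1 - {0}) (\<lambda>x::real^'n. x \<bullet> x)"
      by (intro continuous_intros)
    ultimately have "continuous_on (ball 0 1 - {0 :: real^'n}) (\<lambda>x. f' (x \<bullet> x))"
      "continuous_on (ball 0 1 - {0 :: real^'n}) (\<lambda>x. h' (x \<bullet> x))"
      "continuous_on (ball 0 1 - {0 :: real^'n}) (\<lambda>x. h (x \<bullet> x))"
      using continuous_on_compose2[OF _ _ sub] cont by blast+
    then show ?thesis unfolding comp by (intro continuous_intros)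
  qed
  show "(\<Sum>i\<in>UNIV. X' x (axis i 1) $ i) =
      x $ k * (2 * f' (x \<bullet> x) + 2 * (x \<bullet> x) * h' (x \<bullet> x) + (real CARD('n) + 1) * h (x \<bullet> x))" for x
  proof -
    have d: "(\<Sum>i\<in>UNIV. axis k 1 $ i * c i) = c k" for c :: "'n \<Rightarrow> real"
    proof -
      have "axis k 1 $ i * c i = (if i = k then c i else 0)" for i by (simp add: axis_def)
      then show ?thesis by simp
    qed
    have "(\<Sum>i\<in>UNIV. x $ i * x $ i) = x \<bullet> x" by (simp add: inner_vec_def)
    then show ?thesis
      unfolding comp sum.distrib d sum_distrib_left[symmetric] by (simp add: algebra_simps)
  qed
qed

text \<open>Without the logarithmic factor of the profile this is, up to a constant, the k-th partial derivative
of the fundamental solution of the Laplace equation.\<close>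

definition dipole :: "'n \<Rightarrow> real^'n \<Rightarrow> real" where
  "dipole k x = x $ k * profile (real CARD('n)) (x \<bullet> x)"

text \<open>Twice the derivative of the profile in s.\<close>

definition profile_slope :: "real \<Rightarrow> real \<Rightarrow> real" where
  "profile_slope N s = s powr (- N / 2 - 1) * ((invlog s)\<^sup>2 * (4 * invlog s - N))"

definition dipole_grad :: "'n \<Rightarrow> real^'n \<Rightarrow> real^'n" where
  "dipole_grad k x = profile (real CARD('n)) (x \<bullet> x) *\<^sub>R axis k 1
     + (x $ k * profile_slope (real CARD('n)) (x \<bullet> x)) *\<^sub>R x"

text \<open>The solution of the algebraic equation that the vanishing of the divergence of the flux imposes on
the excess of the tangential conductivity over the radial one, where z = invlog s.\<close>

definition anisotropy :: "real \<Rightarrow> real \<Rightarrow> real" where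
  "anisotropy N z = (24 * z\<^sup>2 - 4 * N * z) / (N - 1)"

text \<open>I + c (I - x x^T / |x|^2): the conductivity is 1 in the radial direction and 1 + c in the tangential
ones. At x = 0 both c and the quotient are 0, and the matrix is the identity.\<close>

definition coeff_matrix :: "real^'n \<Rightarrow> real^'n^'n" where
  "coeff_matrix x = (let c = anisotropy (real CARD('n)) (invlog (x \<bullet> x)) in
     \<chi> i j. (1 + c) * (if i = j then 1 else 0) - c * (x $ i * x $ j / (x \<bullet> x)))"

text \<open>The product of the coefficient matrix and the gradient, as an axial field.\<close>

definition flux :: "'n \<Rightarrow> real^'n \<Rightarrow> real^'n" where
  "flux k x = (let s = x \<bullet> x; z = invlog s; N = real CARD('n); c = anisotropy N z in
     (s powr (- N / 2) * (z\<^sup>2 * (1 + c))) *\<^sub>R axis k 1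
     + (x $ k * (s powr (- N / 2 - 1) * (z\<^sup>2 * (4 * z - N - c)))) *\<^sub>R x)"

lemma borel_measurable_vec_component [measurable]: "(\<lambda>x :: real^'n. x $ k) \<in> borel_measurable borel"
  by (intro borel_measurable_continuous_onI continuous_intros)

lemma borel_measurable_dipole [measurable]:
  "dipole k \<in> borel_measurable borel" "dipole_grad k \<in> borel_measurable borel"
  "flux k \<in> borel_measurable borel"
  unfolding dipole_def[abs_def] dipole_grad_def[abs_def] flux_def[abs_def] profile_slope_def[abs_def]
    anisotropy_def[abs_def] Let_def
  by measurable

lemma coeff_matrix_mult:
  "coeff_matrix x *v \<xi> = (1 + anisotropy (real CARD('n)) (invlog (x \<bullet> x))) *\<^sub>R \<xi>
     - (anisotropy (real CARD('n)) (invlog (x \<bullet> x)) * (x \<bullet> \<xi>) / (x \<bullet> x)) *\<^sub>R x"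
  for x \<xi> :: "real^'n"
proof -
  define c where "c = anisotropy (real CARD('n)) (invlog (x \<bullet> x))"
  have "(coeff_matrix x *v \<xi>) $ i = (1 + c) * \<xi> $ i - c * (x \<bullet> \<xi>) / (x \<bullet> x) * x $ i" for i
  proof -
    define d where "d = c * x $ i / (x \<bullet> x)"
    have "(coeff_matrix x *v \<xi>) $ i =
        (\<Sum>j\<in>UNIV. (if i = j then (1 + c) * \<xi> $ j else 0) - d * (x $ j * \<xi> $ j))"
      unfolding d_def matrix_vector_mult_def coeff_matrix_def Let_def c_def[symmetric]
      by (auto intro!: sum.cong simp: algebra_simps)
    also have "\<dots> = (1 + c) * \<xi> $ i - d * (x \<bullet> \<xi>)"
      by (simp add: sum_subtractf sum_distrib_left[symmetric] inner_vec_def)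
    finally show ?thesis by (simp add: d_def)
  qed
  then show ?thesis by (simp add: vec_eq_iff c_def)
qed

lemma coeff_matrix_mult_dipole_grad: "coeff_matrix x *v dipole_grad k x = flux k x"
  for x :: "real^'n"
proof (cases "x = 0")
  case True
  then show ?thesis by (simp add: dipole_grad_def flux_def profile_def)
next
  case False
  define s z N where "s = x \<bullet> x" and "z = invlog s" and "N = real CARD('n)"
  define c where "c = anisotropy N z"
  define P where "P = s powr (- N / 2 - 1)"
  have s: "0 < s" using False by (simp add: s_def)
  have P: "s powr (- N / 2) = s * P" unfolding P_def using s by (simp add: powr_mult_base)
  have g: "dipole_grad k x = (s * P * z\<^sup>2) *\<^sub>R axis k 1 + (x $ k * (P * (z\<^sup>2 * (4 * z - N)))) *\<^sub>R x"
    unfolding dipole_grad_def profile_def profile_slope_def s_def[symmetric] N_def[symmetric]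
      z_def[symmetric] P_def[symmetric] P ..
  have "x \<bullet> dipole_grad k x = s * P * z\<^sup>2 * x $ k + x $ k * (P * (z\<^sup>2 * (4 * z - N))) * s"
    unfolding g by (simp add: inner_add_right inner_axis flip: s_def)
  also have "\<dots> = s * (x $ k * P * z\<^sup>2 * (1 + (4 * z - N)))"
    by (simp add: algebra_simps)
  finally have ip: "c * (x \<bullet> dipole_grad k x) / s = c * (x $ k * P * z\<^sup>2 * (1 + (4 * z - N)))"
    using s by simp
  have f: "flux k x = (s * P * (z\<^sup>2 * (1 + c))) *\<^sub>R axis k 1 + (x $ k * (P * (z\<^sup>2 * (4 * z - N - c)))) *\<^sub>R x"
    unfolding flux_def Let_def s_def[symmetric] N_def[symmetric] z_def[symmetric] c_def[symmetric]
      P_def[symmetric] P ..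
  show ?thesis
    unfolding coeff_matrix_mult s_def[symmetric] N_def[symmetric] z_def[symmetric] c_def[symmetric] ip f
    unfolding g by (simp add: vec_eq_iff algebra_simps)
qed

lemma continuous_on_powr_invlog:
  assumes "continuous_on UNIV q"
  shows "continuous_on {0<..<1} (\<lambda>s. s powr a * q (invlog s))"
proof -
  have "continuous_on {0<..<1} invlog"
    by (intro continuous_at_imp_continuous_on ballI isCont_invlog) auto
  then have "continuous_on {0<..<1} (\<lambda>s. q (invlog s))"
    by (rule continuous_on_compose2[OF assms]) auto
  then show ?thesis by (intro continuous_intros) auto
qed

lemma has_real_derivative_profile:
  assumes "0 < s" "s < 1"
  shows "(profile N has_real_derivative profile_slope N s / 2) (at s)"
proof -
  have "((\<lambda>z. z\<^sup>2) has_real_derivative 2 * invlog s) (at (invlog s))"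
    by (auto intro!: derivative_eq_intros)
  from has_real_derivative_powr_invlog[OF assms this, of "- N / 2"] show ?thesis
    unfolding profile_def[abs_def] profile_slope_def
    by (rule DERIV_cong) (simp add: power2_eq_square algebra_simps)
qed

lemma dipole_has_derivative:
  fixes x :: "real^'n"
  assumes "x \<in> ball 0 1 - {0}"
  shows "(dipole k has_derivative (\<lambda>v. dipole_grad k x \<bullet> v)) (at x)"
proof -
  have sq: "((\<lambda>x::real^'n. x \<bullet> x) has_derivative (\<lambda>v. 2 * (x \<bullet> v))) (at x)"
    by (auto intro!: derivative_eq_intros simp: inner_commute)
  note P = DERIV_compose_FDERIV[OF has_real_derivative_profile[OF unit_ball_inner_self[OF assms]] sq]
  have K: "((\<lambda>x. x $ k) has_derivative (\<lambda>v. v $ k)) (at x)"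
    by (rule bounded_linear_imp_has_derivative[OF bounded_linear_vec_nth])
  show ?thesis
    unfolding dipole_def[abs_def]
    by (rule has_derivative_eq_rhs[OF has_derivative_mult[OF K P]])
      (simp add: dipole_grad_def fun_eq_iff inner_add_left inner_axis' algebra_simps)
qed

text \<open>For coefficients f and h of an axial field, the equation reads 2 f' + 2 s h' + (N + 1) h = 0. The
derivative of the anisotropy cancels in it, which leaves (N - 1) c = 24 z^2 - 4 N z.\<close>

lemma flux_divergence_free:
  fixes k :: "'n::finite"
  assumes "CARD('n) \<ge> 2"
  obtains X' :: "real^'n \<Rightarrow> real^'n \<Rightarrow> real^'n" where
    "\<And>x. x \<in> ball 0 1 - {0} \<Longrightarrow> (flux k has_derivative X' x) (at x)"
    "\<And>i. continuous_on (ball 0 1 - {0}) (\<lambda>x. X' x (axis i 1) $ i)"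
    "\<And>x. x \<in> ball 0 1 - {0} \<Longrightarrow> (\<Sum>i\<in>UNIV. X' x (axis i 1) $ i) = 0"
proof -
  define N where "N = real CARD('n)"
  have N: "N \<ge> 2" using assms by (simp add: N_def)
  define c where "c = anisotropy N"
  define c' where "c' z = (48 * z - 4 * N) / (N - 1)" for z
  define qf where "qf z = z\<^sup>2 * (1 + c z)" for z
  define qf' where "qf' z = 2 * z * (1 + c z) + z\<^sup>2 * c' z" for z
  define qh where "qh z = z\<^sup>2 * (4 * z - N - c z)" for z
  define qh' where "qh' z = 2 * z * (4 * z - N - c z) + z\<^sup>2 * (4 - c' z)" for z
  have c: "(c has_real_derivative c' z) (at z)" for z
    unfolding c_def anisotropy_def[abs_def] c'_def using N by (auto intro!: derivative_eq_intros)
  have qf: "(qf has_real_derivative qf' z) (at z)" for z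
    unfolding qf_def[abs_def] qf'_def by (auto intro!: derivative_eq_intros c)
  have qh: "(qh has_real_derivative qh' z) (at z)" for z
    unfolding qh_def[abs_def] qh'_def by (auto intro!: derivative_eq_intros c)
  have contq: "continuous_on UNIV qf" "continuous_on UNIV qf'" "continuous_on UNIV qh" "continuous_on UNIV qh'"
    unfolding qf_def[abs_def] qf'_def[abs_def] qh_def[abs_def] qh'_def[abs_def] c_def anisotropy_def[abs_def]
      c'_def[abs_def] using N by (auto intro!: continuous_intros)
  define f where "f s = s powr (- N / 2) * qf (invlog s)" for s
  define h where "h s = s powr (- N / 2 - 1) * qh (invlog s)" for s
  define f' where "f' s = s powr (- N / 2 - 1) * (- N / 2 * qf (invlog s) + (invlog s)\<^sup>2 * qf' (invlog s))" for s
  define h' where "h' s = s powr (- N / 2 - 1 - 1) * ((- N / 2 - 1) * qh (invlog s) + (invlog s)\<^sup>2 * qh' (invlog s))" for s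
  have f: "(f has_real_derivative f' s) (at s)" if "0 < s" "s < 1" for s
    unfolding f_def[abs_def] f'_def by (rule has_real_derivative_powr_invlog[OF that qf])
  have h: "(h has_real_derivative h' s) (at s)" if "0 < s" "s < 1" for s
    unfolding h_def[abs_def] h'_def by (rule has_real_derivative_powr_invlog[OF that qh])
  have cont: "continuous_on {0<..<1} f'" "continuous_on {0<..<1} h'"
    unfolding f'_def[abs_def] h'_def[abs_def]
    by (rule continuous_on_powr_invlog[where q = "\<lambda>z. - N / 2 * qf z + z\<^sup>2 * qf' z"]
        continuous_on_powr_invlog[where q = "\<lambda>z. (- N / 2 - 1) * qh z + z\<^sup>2 * qh' z"];
        intro continuous_intros contq)+
  have flux: "flux k = (\<lambda>x. f (x \<bullet> x) *\<^sub>R axis k 1 + (x $ k * h (x \<bullet> x)) *\<^sub>R x)"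
    by (simp add: fun_eq_iff flux_def f_def h_def Let_def qf_def qh_def c_def N_def)
  have zero: "2 * f' s + 2 * s * h' s + (N + 1) * h s = 0" if "0 < s" for s
  proof -
    define z where "z = invlog s"
    define P where "P = s powr (- N / 2 - 1)"
    have P: "s * s powr (- N / 2 - 1 - 1) = P"
    proof -
      have "s * s powr (a - 1) = s powr a" for a
        using that by (simp add: powr_mult_base)
      then show ?thesis by (simp only: P_def)
    qed
    have cz: "(N - 1) * c z = 24 * z\<^sup>2 - 4 * N * z"
      using N by (simp add: c_def anisotropy_def)
    have "2 * f' s + 2 * s * h' s + (N + 1) * h s
        = P * (2 * (- N / 2 * qf z + z\<^sup>2 * qf' z))
          + 2 * (s * s powr (- N / 2 - 1 - 1)) * ((- N / 2 - 1) * qh z + z\<^sup>2 * qh' z)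
          + (N + 1) * (P * qh z)"
      by (simp add: f'_def h'_def h_def P_def z_def)
    also have "\<dots> = P * (- N * qf z - qh z + 2 * z\<^sup>2 * (qf' z + qh' z))"
      unfolding P by (simp add: algebra_simps)
    also have "- N * qf z - qh z + 2 * z\<^sup>2 * (qf' z + qh' z)
        = z\<^sup>2 * (- ((N - 1) * c z) - 4 * z + 4 * z * (1 + 4 * z - N) + 8 * z\<^sup>2)"
      unfolding qf_def qf'_def qh_def qh'_def by algebra
    also have "\<dots> = 0" unfolding cz by algebra
    finally show ?thesis by simp
  qed
  obtain X' :: "real^'n \<Rightarrow> real^'n \<Rightarrow> real^'n" where
    "\<And>x. x \<in> ball 0 1 - {0} \<Longrightarrow>
      ((\<lambda>x. f (x \<bullet> x) *\<^sub>R axis k 1 + (x $ k * h (x \<bullet> x)) *\<^sub>R x) has_derivative X' x) (at x)"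
    "\<And>i. continuous_on (ball 0 1 - {0}) (\<lambda>x. X' x (axis i 1) $ i)"
    "\<And>x. (\<Sum>i\<in>UNIV. X' x (axis i 1) $ i) =
      x $ k * (2 * f' (x \<bullet> x) + 2 * (x \<bullet> x) * h' (x \<bullet> x) + (real CARD('n) + 1) * h (x \<bullet> x))"
    using axial_field_divergence[OF f h cont] by blast
  then show thesis
    using zero unit_ball_inner_self by (intro that[of X']) (simp_all add: flux flip: N_def)
qed

section \<open>The elliptic equation\<close>

lemma anisotropy_bound:
  assumes "N \<ge> 2" "0 \<le> z" "z \<le> 1 / 16"
  shows "\<bar>anisotropy N z\<bar> \<le> 1 / 2"
proof -
  define w where "w = N * z"
  have "0 \<le> w" unfolding w_def using assms by simp
  moreover have "w \<le> N * (1 / 16)"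
    unfolding w_def by (rule mult_left_mono) (use assms in linarith)+
  moreover have "z\<^sup>2 \<le> (1 / 16)\<^sup>2" by (rule power_mono) (use assms in linarith)+
  then have "z\<^sup>2 \<le> 1 / 256" by (simp add: power2_eq_square)
  ultimately have "24 * z\<^sup>2 - 4 * w \<le> (N - 1) / 2" "- (24 * z\<^sup>2 - 4 * w) \<le> (N - 1) / 2"
    using assms(1) zero_le_power2[of z] by argo+
  then have "\<bar>24 * z\<^sup>2 - 4 * w\<bar> \<le> (N - 1) / 2" by linarith
  then have "\<bar>24 * z\<^sup>2 - 4 * N * z\<bar> \<le> (N - 1) / 2" by (simp only: w_def mult.assoc)
  then show ?thesis using assms(1) by (simp add: anisotropy_def abs_divide pos_divide_le_eq)
qed

lemma inner_self_less_1: "x \<bullet> x < 1" if "x \<in> ball 0 1" for x :: "'a::real_inner"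
  using unit_ball_inner_self(2)[of x] that by (cases "x = 0") auto

lemma coeff_anisotropy_bound:
  fixes x :: "real^'n"
  assumes "CARD('n) \<ge> 2" "x \<in> ball 0 1"
  shows "\<bar>anisotropy (real CARD('n)) (invlog (x \<bullet> x))\<bar> \<le> 1 / 2"
  using assms inner_self_less_1[OF assms(2)] by (intro anisotropy_bound invlog_bounds) auto

lemma inner_square_quotient_le:
  fixes x \<xi> :: "'a::real_inner"
  shows "0 \<le> (x \<bullet> \<xi>)\<^sup>2 / (x \<bullet> x)" "(x \<bullet> \<xi>)\<^sup>2 / (x \<bullet> x) \<le> (norm \<xi>)\<^sup>2"
proof -
  show "0 \<le> (x \<bullet> \<xi>)\<^sup>2 / (x \<bullet> x)" by simp
  show "(x \<bullet> \<xi>)\<^sup>2 / (x \<bullet> x) \<le> (norm \<xi>)\<^sup>2"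
  proof (cases "x = 0")
    case False
    then have "0 < x \<bullet> x" by simp
    moreover have "(x \<bullet> \<xi>)\<^sup>2 \<le> (norm \<xi>)\<^sup>2 * (x \<bullet> x)"
      using Cauchy_Schwarz_ineq[of x \<xi>] by (simp add: power2_norm_eq_inner mult.commute)
    ultimately show ?thesis by (simp add: pos_divide_le_eq)
  qed simp
qed

text \<open>Subtracting the projection onto x adds at most the factor |c|, so the norm grows by at most
1 + 2 |c|, and |c| is at most 1/2.\<close>

lemma norm_coeff_matrix_mult_le:
  fixes x \<xi> :: "real^'n"
  assumes "CARD('n) \<ge> 2" "x \<in> ball 0 1"
  shows "norm (coeff_matrix x *v \<xi>) \<le> 2 * norm \<xi>"
proof -
  define c where "c = anisotropy (real CARD('n)) (invlog (x \<bullet> x))"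
  have c: "\<bar>c\<bar> \<le> 1 / 2" using coeff_anisotropy_bound[OF assms] by (simp add: c_def)
  have "norm ((x \<bullet> \<xi> / (x \<bullet> x)) *\<^sub>R x) \<le> norm \<xi>"
  proof (cases "x = 0")
    case False
    have "norm ((x \<bullet> \<xi> / (x \<bullet> x)) *\<^sub>R x) = \<bar>x \<bullet> \<xi>\<bar> * norm x / (norm x * norm x)"
      by (simp add: dot_square_norm power2_eq_square)
    also have "\<dots> \<le> (norm x * norm \<xi>) * norm x / (norm x * norm x)"
      by (intro divide_right_mono mult_right_mono Cauchy_Schwarz_ineq2) auto
    also have "\<dots> = norm \<xi>" using False by simp
    finally show ?thesis .
  qed simp
  then have "norm (c *\<^sub>R ((x \<bullet> \<xi> / (x \<bullet> x)) *\<^sub>R x)) \<le> 1 / 2 * norm \<xi>"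
    unfolding norm_scaleR[of c] using c by (intro mult_mono) auto
  moreover have "norm ((1 + c) *\<^sub>R \<xi>) \<le> 3 / 2 * norm \<xi>"
    unfolding norm_scaleR using c by (intro mult_right_mono) auto
  moreover have "coeff_matrix x *v \<xi> = (1 + c) *\<^sub>R \<xi> - c *\<^sub>R ((x \<bullet> \<xi> / (x \<bullet> x)) *\<^sub>R x)"
    by (simp add: coeff_matrix_mult c_def)
  moreover have "norm (a - b) \<le> 2 * r" if "norm b \<le> 1 / 2 * r" "norm a \<le> 3 / 2 * r"
    for a b :: "real^'n" and r
    using norm_triangle_ineq4[of a b] that by linarith
  ultimately show ?thesis by (simp only:)
qed

lemma abs_coeff_matrix_entry_le:
  fixes x :: "real^'n"
  assumes "CARD('n) \<ge> 2" "x \<in> ball 0 1"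
  shows "\<bar>coeff_matrix x $ i $ j\<bar> \<le> 2"
proof -
  have "coeff_matrix x $ i $ j = (coeff_matrix x *v axis j 1) $ i"
    by (simp add: matrix_vector_mult_basis column_def)
  also have "\<bar>\<dots>\<bar> \<le> norm (coeff_matrix x *v axis j 1)" by (rule component_le_norm_cart)
  also have "\<dots> \<le> 2" using norm_coeff_matrix_mult_le[OF assms, of "axis j 1"] by simp
  finally show ?thesis .
qed

lemma continuous_on_invlog_inner: "continuous_on (ball 0 1) (\<lambda>x :: 'a::real_inner. invlog (x \<bullet> x))"
proof (rule continuous_on_compose2[where g = invlog and t = "{..<1}"])
  show "continuous_on {..<1} invlog"
    by (intro continuous_at_imp_continuous_on ballI isCont_invlog) simp
qed (auto intro!: continuous_intros inner_self_less_1)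

text \<open>The direction x / |x| has no limit at the origin, but its entries are bounded, and they are multiplied
by the anisotropy, which tends to 0 there like 1 / log.\<close>

lemma continuous_on_coeff_matrix:
  assumes "CARD('n::finite) \<ge> 2"
  shows "continuous_on (ball 0 1) (coeff_matrix :: real^'n \<Rightarrow> real^'n^'n)"
proof -
  define c :: "real^'n \<Rightarrow> real" where "c x = anisotropy (real CARD('n)) (invlog (x \<bullet> x))" for x
  have c: "continuous_on (ball 0 1) c"
    unfolding c_def[abs_def] anisotropy_def using assms
    by (intro continuous_intros continuous_on_invlog_inner) auto
  have c0: "c 0 = 0" by (simp add: c_def anisotropy_def invlog_def)
  have r: "continuous_on (ball 0 1) (\<lambda>x. c x * (x $ i * x $ j / (x \<bullet> x)))" for i j
  proof (intro continuous_at_imp_continuous_on ballI)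
    fix x :: "real^'n" assume x: "x \<in> ball 0 1"
    have cx: "isCont c x"
      using c x by (simp add: continuous_on_eq_continuous_at)
    show "isCont (\<lambda>x. c x * (x $ i * x $ j / (x \<bullet> x))) x"
    proof (cases "x = 0")
      case False
      with cx show ?thesis by (intro continuous_intros) auto
    next
      case True
      have "(c \<longlongrightarrow> 0) (at 0)" using cx c0 True by (simp add: isCont_def)
      then have lim: "((\<lambda>x. \<bar>c x\<bar>) \<longlongrightarrow> 0) (at 0)" by (rule tendsto_rabs_zero)
      have "norm (c x * (x $ i * x $ j / (x \<bullet> x))) \<le> \<bar>c x\<bar>" for x
      proof -
        have "\<bar>x $ i\<bar> * \<bar>x $ j\<bar> \<le> norm x * norm x"
          by (intro mult_mono component_le_norm_cart) auto
        then have "\<bar>x $ i * x $ j / (x \<bullet> x)\<bar> \<le> 1"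
          by (cases "x = 0") (simp_all add: abs_mult dot_square_norm power2_eq_square)
        then have "\<bar>c x\<bar> * \<bar>x $ i * x $ j / (x \<bullet> x)\<bar> \<le> \<bar>c x\<bar> * 1"
          by (intro mult_left_mono) auto
        then show ?thesis by (simp add: abs_mult)
      qed
      then have "((\<lambda>x. c x * (x $ i * x $ j / (x \<bullet> x))) \<longlongrightarrow> 0) (at 0)"
        by (intro Lim_null_comparison[OF _ lim] always_eventually allI)
      then show ?thesis using True by (simp add: isCont_def)
    qed
  qed
  have "coeff_matrix = (\<lambda>x :: real^'n. \<chi> i j. (1 + c x) * (if i = j then 1 else 0) - c x * (x $ i * x $ j / (x \<bullet> x)))"
    by (simp add: fun_eq_iff coeff_matrix_def c_def Let_def)
  moreover have "continuous_on (ball 0 1)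
      (\<lambda>x :: real^'n. \<chi> i j. (1 + c x) * (if i = j then 1 else 0) - c x * (x $ i * x $ j / (x \<bullet> x)))"
    by (intro continuous_on_vec_lambda continuous_on_diff continuous_on_mult continuous_on_add
        continuous_on_const c r)
  ultimately show ?thesis by (simp only:)
qed

text \<open>The quadratic form is |\<xi>|^2 + c t, where t is the squared length of the part of \<open>\<xi>\<close> orthogonal to x.\<close>

lemma elliptic_coeff_matrix:
  assumes "CARD('n::finite) \<ge> 2"
  shows "elliptic (ball 0 1) (coeff_matrix :: real^'n \<Rightarrow> real^'n^'n)"
proof -
  have "norm (coeff_matrix x) \<le> real CARD('n) * (real CARD('n) * 2)" if "x \<in> ball 0 1" for x :: "real^'n"
  proof -
    have "norm (coeff_matrix x $ i) \<le> real CARD('n) * 2" for i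
    proof -
      have "norm (coeff_matrix x $ i) \<le> (\<Sum>j\<in>UNIV. \<bar>coeff_matrix x $ i $ j\<bar>)"
        by (rule norm_le_l1_cart)
      also have "\<dots> \<le> (\<Sum>j\<in>(UNIV :: 'n set). 2)"
        by (intro sum_mono abs_coeff_matrix_entry_le assms that)
      finally show ?thesis by simp
    qed
    moreover have "norm (coeff_matrix x) \<le> (\<Sum>i\<in>UNIV. norm (coeff_matrix x $ i))"
      unfolding norm_vec_def[of "coeff_matrix x"] by (rule L2_set_le_sum) simp
    ultimately have "norm (coeff_matrix x) \<le> (\<Sum>i\<in>(UNIV :: 'n set). real CARD('n) * 2)"
      by (meson order_trans sum_mono)
    then show ?thesis by simp
  qed
  then have "bounded ((coeff_matrix :: real^'n \<Rightarrow> real^'n^'n) ` ball 0 1)"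
    unfolding bounded_iff by blast
  moreover have "(coeff_matrix :: real^'n \<Rightarrow> real^'n^'n) \<in> borel_measurable (lebesgue_on (ball 0 1))"
    by (intro continuous_imp_measurable_on_sets_lebesgue continuous_on_coeff_matrix assms) auto
  moreover have "transpose (coeff_matrix x) = coeff_matrix x" for x :: "real^'n"
    by (simp add: transpose_def coeff_matrix_def vec_eq_iff Let_def mult.commute)
  moreover have "1 / 2 * (norm \<xi>)\<^sup>2 \<le> (coeff_matrix x *v \<xi>) \<bullet> \<xi> \<and>
      (coeff_matrix x *v \<xi>) \<bullet> \<xi> \<le> 3 / 2 * (norm \<xi>)\<^sup>2" if "x \<in> ball 0 1" for x \<xi> :: "real^'n"
  proof -
    define c where "c = anisotropy (real CARD('n)) (invlog (x \<bullet> x))"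
    have c: "\<bar>c\<bar> \<le> 1 / 2" using coeff_anisotropy_bound[OF assms that] by (simp add: c_def)
    define t where "t = (norm \<xi>)\<^sup>2 - (x \<bullet> \<xi>)\<^sup>2 / (x \<bullet> x)"
    have t: "0 \<le> t" "t \<le> (norm \<xi>)\<^sup>2"
      using inner_square_quotient_le[of x \<xi>] by (simp_all add: t_def)
    have "(coeff_matrix x *v \<xi>) \<bullet> \<xi> = (norm \<xi>)\<^sup>2 + c * t"
      unfolding coeff_matrix_mult c_def[symmetric]
      by (simp add: t_def inner_diff_left power2_norm_eq_inner algebra_simps) (simp add: power2_eq_square)
    moreover have "\<bar>c * t\<bar> \<le> 1 / 2 * (norm \<xi>)\<^sup>2"
      unfolding abs_mult using c t by (intro mult_mono) auto
    ultimately show ?thesis by (auto simp: abs_le_iff)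
  qed
  ultimately show ?thesis
    unfolding elliptic_def by (intro conjI exI[of _ "1 / 2"] exI[of _ "3 / 2"] ballI allI) auto
qed

lemma abs_dipole_le: "\<bar>dipole k x\<bar> \<le> norm x * profile (real CARD('n)) (x \<bullet> x)" for x :: "real^'n"
  unfolding dipole_def abs_mult abs_of_nonneg[OF profile_nonneg]
  by (intro mult_right_mono component_le_norm_cart profile_nonneg)

lemma norm_dipole_grad_le:
  fixes x :: "real^'n"
  assumes "x \<in> ball 0 1"
  shows "norm (dipole_grad k x) \<le> (real CARD('n) + 1) * profile (real CARD('n)) (x \<bullet> x)"
proof (cases "x = 0")
  case True
  then show ?thesis by (simp add: dipole_grad_def profile_def)
next
  case False
  define s z N where "s = x \<bullet> x" and "z = invlog s" and "N = real CARD('n)"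
  have s: "0 < s" "s < 1" using False assms unit_ball_inner_self[of x] by (auto simp: s_def)
  have z: "0 \<le> z" "z \<le> 1 / 16" using invlog_bounds[OF s(2)] by (simp_all add: z_def)
  have N: "1 \<le> N" by (simp add: N_def Suc_leI)
  have sl: "s * profile_slope N s = profile N s * (4 * z - N)"
    using s(1) powr_mult_base[of s "- N / 2 - 1"] by (simp add: profile_slope_def profile_def z_def)
  have "norm ((x $ k * profile_slope N s) *\<^sub>R x) = \<bar>x $ k\<bar> * norm x * \<bar>profile_slope N s\<bar>"
    by (simp add: abs_mult)
  also have "\<dots> \<le> norm x * norm x * \<bar>profile_slope N s\<bar>"
    by (intro mult_right_mono component_le_norm_cart) auto
  also have "\<dots> = \<bar>s * profile_slope N s\<bar>"
    by (simp add: s_def abs_mult dot_square_norm power2_eq_square)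
  also have "\<dots> = profile N s * \<bar>4 * z - N\<bar>"
    unfolding sl by (simp add: abs_mult profile_nonneg)
  also have "\<dots> \<le> profile N s * N"
    using z N by (intro mult_left_mono profile_nonneg) auto
  finally have "norm ((x $ k * profile_slope N s) *\<^sub>R x) \<le> profile N s * N" .
  moreover have "norm (profile N s *\<^sub>R axis k (1::real)) = profile N s"
    by (simp add: profile_nonneg)
  ultimately show ?thesis
    using norm_triangle_ineq[of "profile N s *\<^sub>R axis k 1" "(x $ k * profile_slope N s) *\<^sub>R x"]
    by (simp add: dipole_grad_def algebra_simps flip: s_def N_def)
qed

lemma norm_flux_le:
  fixes x :: "real^'n"
  assumes "CARD('n) \<ge> 2" "x \<in> ball 0 1"
  shows "norm (flux k x) \<le> 2 * ((real CARD('n) + 1) * profile (real CARD('n)) (x \<bullet> x))"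
  using norm_coeff_matrix_mult_le[OF assms, of "dipole_grad k x"] norm_dipole_grad_le[OF assms(2), of k]
  by (simp add: coeff_matrix_mult_dipole_grad)

lemma set_integrable_le_profile:
  fixes f :: "real^'n \<Rightarrow> 'b::{banach, second_countable_topology}"
  assumes "f \<in> borel_measurable borel"
    and "\<And>x. x \<in> ball 0 1 \<Longrightarrow> norm (f x) \<le> C * profile (real CARD('n)) (x \<bullet> x)"
  shows "set_integrable lborel (ball 0 1) f"
proof (rule set_integrable_bound)
  show "set_integrable lborel (ball 0 1) (\<lambda>x :: real^'n. C * profile (real CARD('n)) (x \<bullet> x))"
    using set_integrable_profile[where 'a = "real^'n"] by (intro set_integrable_mult_right) simp
  show "set_borel_measurable lborel (ball 0 1) f"
    unfolding set_borel_measurable_def using assms(1)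
    by (intro borel_measurable_scaleR borel_measurable_indicator) simp_all
  show "AE x in lborel. x \<in> ball 0 1 \<longrightarrow> norm (f x) \<le> norm (C * profile (real CARD('n)) (x \<bullet> x))"
    using assms(2) by (intro AE_I2) (auto intro: order_trans[OF _ abs_ge_self])
qed

lemma Lp_loc_1I:
  fixes f :: "real^'n \<Rightarrow> 'b::euclidean_space"
  assumes [measurable]: "f \<in> borel_measurable borel" and int: "set_integrable lborel \<Omega> f"
  shows "f \<in> Lp_loc 1 \<Omega>"
  unfolding Lp_loc_def
proof (intro CollectI conjI allI impI)
  show "f \<in> borel_measurable (lebesgue_on \<Omega>)"
    by (intro measurable_restrict_space1 measurable_completion) simp
  fix K :: "(real^'n) set" assume K: "compact K" "K \<subseteq> \<Omega>"
  then have [measurable]: "K \<in> sets borel" by (simp add: borel_compact)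
  have "set_integrable lborel K f"
    by (rule set_integrable_subset[OF int _ K(2)]) simp
  then have "set_integrable lborel K (\<lambda>x. norm (f x))" by (rule set_integrable_norm)
  then show "set_integrable lebesgue K (\<lambda>x. norm (f x) powr 1)"
    unfolding set_integrable_def by (subst integrable_completion) auto
qed

lemma set_integral_lebesgue_eq_lborel:
  fixes f :: "real^'n \<Rightarrow> real"
  assumes [measurable]: "f \<in> borel_measurable borel" "\<Omega> \<in> sets borel"
  shows "(LINT x:\<Omega>|lebesgue. f x) = (LINT x:\<Omega>|lborel. f x)"
  unfolding set_lebesgue_integral_def by (rule integral_completion) simp

lemma C1_c_measurable:
  assumes "\<phi> \<in> C1_c \<Omega>"
  shows "\<phi> \<in> borel_measurable borel" "grad \<phi> \<in> borel_measurable borel"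
  using C1_c_continuous[OF assms] C1_c_continuous_grad[OF assms]
  by (auto intro: borel_measurable_continuous_onI)

lemma continuous_on_dipole_grad: "continuous_on (ball 0 1 - {0}) (dipole_grad k)"
proof -
  let ?B = "ball 0 1 - {0} :: (real^'n) set"
  have sub: "(\<lambda>x::real^'n. x \<bullet> x) ` ?B \<subseteq> {0<..<1}"
  proof (rule image_subsetI)
    fix x :: "real^'n" assume "x \<in> ?B"
    from unit_ball_inner_self[OF this] show "x \<bullet> x \<in> {0<..<1}" by simp
  qed
  have "continuous_on ?B (\<lambda>x. x \<bullet> x)" by (intro continuous_intros)
  note * = continuous_on_compose2[OF continuous_on_powr_invlog this sub]
  have "continuous_on ?B (\<lambda>x. profile (real CARD('n)) (x \<bullet> x))"
    unfolding profile_def by (rule *[of "\<lambda>z. z\<^sup>2"]) (intro continuous_intros)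
  moreover have "continuous_on ?B (\<lambda>x. profile_slope (real CARD('n)) (x \<bullet> x))"
    unfolding profile_slope_def by (rule *[of "\<lambda>z. z\<^sup>2 * (4 * z - real CARD('n))"]) (intro continuous_intros)
  ultimately show ?thesis
    unfolding dipole_grad_def[abs_def] by (intro continuous_intros)
qed

lemma abs_inner_quotient_le:
  fixes v x :: "'a::real_inner"
  shows "\<bar>(v \<bullet> x) / (x \<bullet> x)\<bar> * norm x \<le> norm v"
proof (cases "x = 0")
  case False
  have "\<bar>v \<bullet> x\<bar> * norm x \<le> (norm v * norm x) * norm x"
    by (intro mult_right_mono Cauchy_Schwarz_ineq2) auto
  then show ?thesis
    using False by (simp add: abs_divide dot_square_norm power2_eq_square divide_simps)
qed simp

text \<open>The distributional i-th derivative is the divergence of u times the i-th unit vector. Here u is small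
enough, |u| <= |x| profile, for the singularity to be removable without subtracting a constant.\<close>

lemma has_weak_gradient_dipole:
  fixes k :: "'n::finite"
  shows "has_weak_gradient (ball 0 1) (dipole k) (dipole_grad k)"
  unfolding has_weak_gradient_def
proof (intro conjI ballI allI)
  let ?N = "real CARD('n)"
  let ?p = "\<lambda>x :: real^'n. profile ?N (x \<bullet> x)"
  have u: "\<bar>dipole k x\<bar> \<le> ?p x" if "x \<in> ball 0 1" for x :: "real^'n"
    using abs_dipole_le[of k x] that mult_right_mono[of "norm x" 1 "?p x"]
    by (simp add: profile_nonneg)
  show "dipole k \<in> Lp_loc 1 (ball 0 1)"
    by (intro Lp_loc_1I set_integrable_le_profile[where C = 1]) (use u in auto)
  show "dipole_grad k \<in> Lp_loc 1 (ball 0 1)"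
    by (intro Lp_loc_1I set_integrable_le_profile[where C = "?N + 1"]) (use norm_dipole_grad_le in auto)
  fix \<phi> :: "real^'n \<Rightarrow> real" and i assume \<phi>: "\<phi> \<in> C1_c (ball 0 1)"
  note [measurable] = C1_c_measurable[OF \<phi>]
  obtain C where C: "0 \<le> C" "\<And>x. \<bar>\<phi> x\<bar> \<le> C" "\<And>x. norm (grad \<phi> x) \<le> C"
    using C1_c_bounds[OF \<phi>] by metis
  have 1: "set_integrable lborel (ball 0 1) (\<lambda>x. dipole k x * grad \<phi> x $ i)"
  proof (rule set_integrable_le_profile[where C = C])
    fix x :: "real^'n" assume x: "x \<in> ball 0 1"
    have "\<bar>dipole k x\<bar> * \<bar>grad \<phi> x $ i\<bar> \<le> ?p x * C"
      using u[OF x] C component_le_norm_cart[of "grad \<phi> x" i] profile_nonneg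
      by (intro mult_mono order_trans[OF component_le_norm_cart]) auto
    then show "norm (dipole k x * grad \<phi> x $ i) \<le> C * ?p x" by (simp add: abs_mult mult.commute)
  qed simp
  have 2: "set_integrable lborel (ball 0 1) (\<lambda>x. dipole_grad k x $ i * \<phi> x)"
  proof (rule set_integrable_le_profile[where C = "(?N + 1) * C"])
    fix x :: "real^'n" assume x: "x \<in> ball 0 1"
    have "\<bar>dipole_grad k x $ i\<bar> * \<bar>\<phi> x\<bar> \<le> ((?N + 1) * ?p x) * C"
      using norm_dipole_grad_le[OF x] C profile_nonneg
      by (intro mult_mono order_trans[OF component_le_norm_cart]) auto
    then show "norm (dipole_grad k x $ i * \<phi> x) \<le> (?N + 1) * C * ?p x"
      by (simp add: abs_mult mult.commute mult.left_commute)
  qed simp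
  have "(LINT x:ball 0 1|lborel. (dipole k x *\<^sub>R axis i 1) \<bullet> grad \<phi> x + dipole_grad k x $ i * \<phi> x) = 0"
  proof (rule divergence_theorem_removable_origin[where c = 0])
    show "((\<lambda>x. dipole k x *\<^sub>R (axis i 1 :: real^'n)) has_derivative
        (\<lambda>v. (dipole_grad k x \<bullet> v) *\<^sub>R axis i 1)) (at x)" if "x \<in> ball 0 1 - {0}" for x :: "real^'n"
      by (rule has_derivative_scaleR_left[OF dipole_has_derivative[OF that]])
    show "continuous_on (ball 0 1 - {0}) (\<lambda>x. ((dipole_grad k x \<bullet> axis j 1) *\<^sub>R (axis i 1 :: real^'n)) $ j)" for j
    proof -
      have "continuous_on (ball 0 1 - {0}) (\<lambda>x. dipole_grad k x $ j * axis i 1 $ j)"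
        by (intro continuous_on_mult_right continuous_on_component continuous_on_dipole_grad)
      then show ?thesis by (simp add: inner_axis)
    qed
    show "(\<Sum>j\<in>UNIV. ((dipole_grad k x \<bullet> axis j 1) *\<^sub>R axis i 1) $ j) = dipole_grad k x $ i" for x
      by (simp add: inner_axis) (simp add: axis_def if_distrib cong: if_cong)
    show "set_integrable lborel (ball 0 1) (\<lambda>x. (dipole k x *\<^sub>R axis i 1) \<bullet> grad \<phi> x + dipole_grad k x $ i * \<phi> x)"
      using set_integral_add(1)[OF 1 2] by (simp add: inner_axis')
    show "set_integrable lborel (ball 0 1) (\<lambda>x. (\<phi> x - 0) * ((dipole k x *\<^sub>R axis i 1) \<bullet> x) / (x \<bullet> x))"
    proof (rule set_integrable_le_profile[where C = C])
      fix x :: "real^'n"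
      let ?q = "(axis i 1 \<bullet> x) / (x \<bullet> x)"
      have "\<bar>dipole k x\<bar> * \<bar>?q\<bar> \<le> (norm x * ?p x) * \<bar>?q\<bar>"
        by (intro mult_right_mono abs_dipole_le) auto
      also have "\<dots> = (\<bar>?q\<bar> * norm x) * ?p x" by simp
      also have "\<dots> \<le> 1 * ?p x"
        using abs_inner_quotient_le[of "axis i 1" x] by (intro mult_right_mono profile_nonneg) simp
      finally have "\<bar>\<phi> x\<bar> * (\<bar>dipole k x\<bar> * \<bar>?q\<bar>) \<le> C * ?p x"
        using C by (intro mult_mono) auto
      then show "norm ((\<phi> x - 0) * ((dipole k x *\<^sub>R axis i 1) \<bullet> x) / (x \<bullet> x)) \<le> C * ?p x"
        by (simp add: abs_mult)
    qed simp
  qed (use \<phi> in auto)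
  then have "(LINT x:ball 0 1|lborel. dipole k x * grad \<phi> x $ i) + (LINT x:ball 0 1|lborel. dipole_grad k x $ i * \<phi> x) = 0"
    using set_integral_add(2)[OF 1 2] by (simp add: inner_axis')
  then show "(LINT x:ball 0 1|lebesgue. dipole k x * grad \<phi> x $ i) = - (LINT x:ball 0 1|lebesgue. dipole_grad k x $ i * \<phi> x)"
    by (subst (1 2) set_integral_lebesgue_eq_lborel) auto
qed

text \<open>The flux has the size of the profile, one power of |x| worse than the dipole. The missing power comes
from \<open>\<phi> x - \<phi> 0\<close>; the constant \<open>\<phi> 0\<close> may be subtracted because the flux is even.\<close>

lemma flux_weakly_divergence_free:
  fixes k :: "'n::finite"
  assumes N: "CARD('n) \<ge> 2" and \<phi>: "\<phi> \<in> C1_c (ball 0 1)"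
  shows "(LINT x:ball 0 1|lebesgue. flux k x \<bullet> grad \<phi> x) = 0"
proof -
  let ?N = "real CARD('n)"
  let ?p = "\<lambda>x :: real^'n. profile ?N (x \<bullet> x)"
  note [measurable] = C1_c_measurable[OF \<phi>]
  obtain C where C: "0 \<le> C" "\<And>x. \<bar>\<phi> x\<bar> \<le> C" "\<And>x. norm (grad \<phi> x) \<le> C"
    "\<And>x y. \<bar>\<phi> x - \<phi> y\<bar> \<le> C * norm (x - y)"
    by (rule C1_c_bounds[OF \<phi>]) (rule that)
  obtain X' :: "real^'n \<Rightarrow> real^'n \<Rightarrow> real^'n" where X':
    "\<And>x. x \<in> ball 0 1 - {0} \<Longrightarrow> (flux k has_derivative X' x) (at x)"
    "\<And>i. continuous_on (ball 0 1 - {0}) (\<lambda>x. X' x (axis i 1) $ i)"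
    "\<And>x. x \<in> ball 0 1 - {0} \<Longrightarrow> (\<Sum>i\<in>UNIV. X' x (axis i 1) $ i) = 0"
    by (rule flux_divergence_free[OF N]) (rule that)
  have "(LINT x:ball 0 1|lborel. flux k x \<bullet> grad \<phi> x + 0 * \<phi> x) = 0"
  proof (rule divergence_theorem_removable_origin[OF _ \<phi> _ _ X', where c = "\<phi> 0"])
    show "set_integrable lborel (ball 0 1) (\<lambda>x. flux k x \<bullet> grad \<phi> x + 0 * \<phi> x)"
    proof (rule set_integrable_le_profile[where C = "2 * (?N + 1) * C"])
      fix x :: "real^'n" assume x: "x \<in> ball 0 1"
      have "\<bar>flux k x \<bullet> grad \<phi> x\<bar> \<le> norm (flux k x) * norm (grad \<phi> x)"
        by (rule Cauchy_Schwarz_ineq2)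
      also have "\<dots> \<le> (2 * ((?N + 1) * ?p x)) * C"
        by (intro mult_mono norm_flux_le[OF N x] C(3) mult_nonneg_nonneg profile_nonneg) auto
      finally show "norm (flux k x \<bullet> grad \<phi> x + 0 * \<phi> x) \<le> 2 * (?N + 1) * C * ?p x"
        by (simp add: algebra_simps)
    qed simp
    show "set_integrable lborel (ball 0 1) (\<lambda>x. (\<phi> x - \<phi> 0) * (flux k x \<bullet> x) / (x \<bullet> x))"
    proof (rule set_integrable_le_profile[where C = "2 * (?N + 1) * C"])
      fix x :: "real^'n" assume x: "x \<in> ball 0 1"
      let ?q = "(flux k x \<bullet> x) / (x \<bullet> x)"
      have "\<bar>\<phi> x - \<phi> 0\<bar> * \<bar>?q\<bar> \<le> (C * norm x) * \<bar>?q\<bar>"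
        using C(4)[of x 0] by (intro mult_right_mono) auto
      also have "\<dots> = C * (\<bar>?q\<bar> * norm x)" by simp
      also have "\<dots> \<le> C * (2 * ((?N + 1) * ?p x))"
        by (intro mult_left_mono order_trans[OF abs_inner_quotient_le norm_flux_le[OF N x]] C(1))
      also have "\<dots> = 2 * (?N + 1) * C * ?p x" by (simp add: algebra_simps)
      finally show "norm ((\<phi> x - \<phi> 0) * (flux k x \<bullet> x) / (x \<bullet> x)) \<le> 2 * (?N + 1) * C * ?p x"
        by (simp add: abs_mult)
    qed simp
    show "\<phi> 0 = 0 \<or> (\<forall>x. (x \<in> ball 0 1 \<longleftrightarrow> - x \<in> ball 0 1) \<and> flux k (- x) = flux k x)"
      by (simp add: flux_def Let_def)
  qed auto
  then show ?thesis by (subst set_integral_lebesgue_eq_lborel) auto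
qed

section \<open>Failure of higher integrability\<close>

definition bump :: "'a::real_inner \<Rightarrow> real \<Rightarrow> 'a \<Rightarrow> real" where
  "bump a R x = (max 0 (R\<^sup>2 - (x - a) \<bullet> (x - a)))\<^sup>2"

lemma bump_eq_0: "x \<notin> cball a R \<Longrightarrow> 0 < R \<Longrightarrow> bump a R x = 0"
proof -
  assume *: "x \<notin> cball a R" "0 < R"
  then have "R\<^sup>2 < (norm (x - a))\<^sup>2"
    by (intro power_strict_mono) (auto simp: dist_norm norm_minus_commute)
  then show ?thesis by (simp add: bump_def power2_norm_eq_inner)
qed

lemma bump_bounds: "0 \<le> bump a R x" "bump a R x \<le> R ^ 4"
proof -
  show "0 \<le> bump a R x" by (simp add: bump_def)
  have "max 0 (R\<^sup>2 - (x - a) \<bullet> (x - a)) \<le> R\<^sup>2" by simp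
  then have "bump a R x \<le> (R\<^sup>2)\<^sup>2" unfolding bump_def by (intro power_mono) auto
  then show "bump a R x \<le> R ^ 4" by simp
qed

lemma bump_lower_bound: "R ^ 4 / 2 \<le> bump a R x" if "x \<in> ball a (R / 2)"
proof -
  have "(norm (x - a))\<^sup>2 \<le> (R / 2)\<^sup>2"
    using that by (intro power_mono) (auto simp: dist_norm norm_minus_commute)
  then have "3 / 4 * R\<^sup>2 \<le> R\<^sup>2 - (x - a) \<bullet> (x - a)"
    by (simp add: power2_norm_eq_inner power_divide)
  then have "3 / 4 * R\<^sup>2 \<le> max 0 (R\<^sup>2 - (x - a) \<bullet> (x - a))"
    by (rule order_trans[OF _ max.cobounded2])
  then have "(3 / 4 * R\<^sup>2)\<^sup>2 \<le> bump a R x" unfolding bump_def by (intro power_mono) auto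
  moreover have "(3 / 4 * R\<^sup>2)\<^sup>2 = 9 / 16 * R ^ 4" by (simp add: power_mult_distrib power_divide)
  moreover have "R ^ 4 / 2 \<le> 9 / 16 * R ^ 4" by simp
  ultimately show ?thesis by linarith
qed

lemma bump_in_C1_c:
  fixes a :: "real^'n"
  assumes R: "0 < R" and sub: "cball a R \<subseteq> \<Omega>"
  shows "bump a R \<in> C1_c \<Omega>"
proof -
  define G where "G x = (- 4 * max 0 (R\<^sup>2 - (x - a) \<bullet> (x - a))) *\<^sub>R (x - a)" for x
  have der: "(bump a R has_derivative (\<lambda>h. G x \<bullet> h)) (at x)" for x
  proof -
    have "((\<lambda>x. R\<^sup>2 - (x - a) \<bullet> (x - a)) has_derivative (\<lambda>h. - 2 * ((x - a) \<bullet> h))) (at x)"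
      by (auto intro!: derivative_eq_intros simp: inner_commute)
    from DERIV_compose_FDERIV[OF has_real_derivative_max_square this]
    show ?thesis unfolding bump_def[abs_def]
      by (rule has_derivative_eq_rhs) (simp add: G_def fun_eq_iff)
  qed
  have "grad (bump a R) = G" using grad_unique[OF der] by blast
  moreover have "continuous_on UNIV G"
    unfolding G_def[abs_def] by (intro continuous_intros)
  moreover have supp: "closure {x. bump a R x \<noteq> 0} \<subseteq> cball a R"
  proof (rule closure_minimal)
    show "{x. bump a R x \<noteq> 0} \<subseteq> cball a R" using bump_eq_0[OF _ R] by blast
  qed simp
  moreover have "compact (closure {x. bump a R x \<noteq> 0})"
    using supp by (meson bounded_cball bounded_subset closed_closure compact_eq_bounded_closed)
  moreover have "bump a R differentiable (at x)" for x
    using der differentiable_def by blast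
  ultimately show ?thesis using sub by (simp add: C1_c_def)
qed

text \<open>A splitting at height M that replaces the Hoelder inequality: above M, t is at most t^p M^(1-p).\<close>

lemma le_add_powr:
  fixes t M p :: real
  assumes "0 \<le> t" "0 < M" "1 \<le> p"
  shows "t \<le> M + M powr (1 - p) * t powr p"
proof (cases "t \<le> M")
  case True
  then show ?thesis by (simp add: add_increasing2)
next
  case False
  then have t: "0 < t" "M \<le> t" using assms by auto
  have "t = t powr (1 - p) * t powr p" using t by (simp add: powr_add[symmetric])
  also have "\<dots> \<le> M powr (1 - p) * t powr p"
    using t assms by (intro mult_right_mono powr_mono2') auto
  finally show ?thesis using assms by simp
qed

text \<open>On the axis of the dipole the k-th derivative is profile times 1 - (N - 4 z), and N - 4 z is at least
7/4 in all dimensions from 2 on. In the stated ball the direction x / |x| is so close to the axis that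
x_k^2 / |x|^2 >= 9/10, and (7/4) (9/10) > 3/2. The bound for the profile itself holds because |x|^2 lies
between r^2/2 and 2 r^2.\<close>

lemma dipole_grad_axis_bound:
  fixes x :: "real^'n"
  assumes N: "CARD('n) \<ge> 2" and r: "0 < r" "r \<le> 1 / 4" and x: "x \<in> cball (r *\<^sub>R axis k 1) (r / 4)"
  shows "(2 * r\<^sup>2) powr (- real CARD('n) / 2) / (16 - ln (r\<^sup>2 / 2))\<^sup>2 / 2 \<le> - dipole_grad k x $ k"
proof -
  define s z N where "s = x \<bullet> x" and "z = invlog s" and "N = real CARD('n)"
  define P where "P = profile N s"
  have N2: "2 \<le> N" using N by (simp add: N_def)
  have "(norm (x - r *\<^sub>R axis k 1))\<^sup>2 \<le> (r / 4)\<^sup>2"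
    using x by (intro power_mono) (auto simp: dist_norm norm_minus_commute)
  moreover have "(norm (x - r *\<^sub>R axis k 1))\<^sup>2 = s - (x $ k)\<^sup>2 + (x $ k - r)\<^sup>2"
    unfolding power2_norm_eq_inner
    by (simp add: inner_diff_left inner_diff_right inner_axis inner_axis' s_def power2_eq_square algebra_simps)
  ultimately have d: "s - (x $ k)\<^sup>2 + (x $ k - r)\<^sup>2 \<le> r\<^sup>2 / 16" by (simp add: power_divide)
  have "(x $ k)\<^sup>2 \<le> s"
    using component_le_norm_cart[of x k] power_mono[of "\<bar>x $ k\<bar>" "norm x" 2]
    by (simp add: s_def power2_norm_eq_inner)
  with d have "(x $ k - r)\<^sup>2 \<le> (r / 4)\<^sup>2" by (simp add: power_divide)
  then have "\<bar>x $ k - r\<bar> \<le> r / 4" using r by (simp add: abs_le_square_iff[symmetric])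
  then have xk: "3 / 4 * r \<le> x $ k" "x $ k \<le> 5 / 4 * r" by linarith+
  have "(3 / 4 * r)\<^sup>2 \<le> (x $ k)\<^sup>2" "(x $ k)\<^sup>2 \<le> (5 / 4 * r)\<^sup>2"
    using xk r by (auto intro!: power_mono)
  then have xk2: "9 / 16 * r\<^sup>2 \<le> (x $ k)\<^sup>2" "(x $ k)\<^sup>2 \<le> 25 / 16 * r\<^sup>2"
    by (simp_all add: power_mult_distrib power_divide)
  have r2: "0 < r\<^sup>2" "r\<^sup>2 \<le> (1/4)\<^sup>2" using r by (auto intro: power_mono)
  have d': "s - (x $ k)\<^sup>2 \<le> r\<^sup>2 / 16" using d zero_le_power2[of "x $ k - r"] by linarith
  have s: "r\<^sup>2 / 2 \<le> s" "s \<le> 2 * r\<^sup>2" "0 < s" "s < 1"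
    using xk2 d' r2 \<open>(x $ k)\<^sup>2 \<le> s\<close> by (simp_all add: power2_eq_square)
  have z: "0 \<le> z" "z \<le> 1 / 16" using invlog_bounds[OF s(4)] by (simp_all add: z_def)
  have "9 / 10 * s \<le> (x $ k)\<^sup>2" using d' xk2(1) by linarith
  then have q: "9 / 10 \<le> (x $ k)\<^sup>2 / s" using s(3) by (simp add: pos_le_divide_eq)
  have "3 / 2 \<le> (7 / 4) * (9 / 10 :: real)" by simp
  also have "\<dots> \<le> (N - 4 * z) * ((x $ k)\<^sup>2 / s)"
    using N2 z q by (intro mult_mono) auto
  finally have key: "1 / 2 \<le> (N - 4 * z) * ((x $ k)\<^sup>2 / s) - 1" by simp
  have "s powr (- N / 2 - 1) = s powr (- N / 2) / s"
    using s(3) by (simp add: powr_diff)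
  then have "dipole_grad k x $ k = P - P * ((N - 4 * z) * ((x $ k)\<^sup>2 / s))"
    unfolding dipole_grad_def profile_slope_def P_def profile_def s_def[symmetric] N_def[symmetric]
      z_def[symmetric]
    by (simp add: power2_eq_square algebra_simps add_divide_distrib diff_divide_distrib)
  then have eq: "- dipole_grad k x $ k = P * ((N - 4 * z) * ((x $ k)\<^sup>2 / s) - 1)"
    by (simp add: algebra_simps)
  have "P * (1 / 2) \<le> - dipole_grad k x $ k"
    unfolding eq by (rule mult_left_mono[OF key]) (simp add: P_def profile_nonneg)
  moreover have "(2 * r\<^sup>2) powr (- N / 2) / (16 - ln (r\<^sup>2 / 2))\<^sup>2 \<le> P"
  proof -
    have "(2 * r\<^sup>2) powr (- N / 2) \<le> s powr (- N / 2)"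
      using s N2 by (intro powr_mono2') auto
    moreover have "(1 / (16 - ln (r\<^sup>2 / 2)))\<^sup>2 \<le> z\<^sup>2"
    proof (rule power_mono)
      have "ln (r\<^sup>2 / 2) \<le> ln s" 
        by (rule iffD2[OF ln_le_cancel_iff]) (use s(1,3) r2(1) in linarith)+
      moreover have "ln s < 0" using s by simp
      ultimately have l: "0 < 16 - ln s" "16 - ln s \<le> 16 - ln (r\<^sup>2 / 2)" by simp_all
      then have "0 < 16 - ln (r\<^sup>2 / 2)" by linarith
      with l have "1 / (16 - ln (r\<^sup>2 / 2)) \<le> 1 / (16 - ln s)"
        by (intro divide_left_mono mult_pos_pos) auto
      then show "1 / (16 - ln (r\<^sup>2 / 2)) \<le> z"
        using s(3) by (simp only: z_def invlog_def not_le[symmetric] if_False)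
      show "0 \<le> 1 / (16 - ln (r\<^sup>2 / 2))"
        using \<open>0 < 16 - ln (r\<^sup>2 / 2)\<close> by simp
    qed
    ultimately have "(2 * r\<^sup>2) powr (- N / 2) * (1 / (16 - ln (r\<^sup>2 / 2)))\<^sup>2 \<le> s powr (- N / 2) * z\<^sup>2"
      by (intro mult_mono) auto
    then show ?thesis by (simp add: P_def profile_def z_def power_divide)
  qed
  ultimately show ?thesis by (simp add: N_def)
qed

lemma growth_at_right_0:
  fixes e p :: real
  assumes "0 < e" "0 < p"
  shows "filterlim (\<lambda>r. r powr (- e) / (16 - ln (r\<^sup>2 / 2)) powr p) at_top (at_right 0)"
  using assms by real_asymp

text \<open>Weak gradients are determined by their integrals against test functions, so a competing weak gradient
g in L^p can be compared with the explicit gradient through a single bump in the ball of radius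
R = r/4 about r e, where e is the k-th unit vector. There the k-th derivative of the dipole has a fixed
sign and is, in absolute value, at least a large multiple of M = M r; splitting |g| at the height M gives
M^p R^N <= C with C independent of r. But M^p R^N behaves like r^(-N (p - 1)) up to powers of the
logarithm, which is unbounded.\<close>

lemma dipole_notin_W1p_loc:
  fixes k :: "'n::finite"
  assumes N: "CARD('n) \<ge> 2" and p: "1 < p"
  shows "dipole k \<notin> W1p_loc p (ball 0 1)"
proof
  assume "dipole k \<in> W1p_loc p (ball 0 1)"
  then obtain g where g: "has_weak_gradient (ball 0 1) (dipole k) g" "g \<in> Lp_loc p (ball 0 1)"
    by (auto simp: W1p_loc_def)
  let ?n = "CARD('n)"
  let ?B = "ball 0 1 :: (real^'n) set"
  let ?K = "cball 0 (1 / 2) :: (real^'n) set"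
  have gint: "set_integrable lebesgue ?K (\<lambda>x. norm (g x) powr p)"
  proof -
    have "compact ?K" "?K \<subseteq> ?B" by auto
    then show ?thesis using g(2) unfolding Lp_loc_def by blast
  qed
  define I where "I = (LINT x:?K|lebesgue. norm (g x) powr p)"
  define V where "V = unit_ball_vol (real ?n)"
  have V: "0 < V" by (simp add: V_def)
  define m where "m r = (2 * r\<^sup>2) powr (- real ?n / 2) / (16 - ln (r\<^sup>2 / 2))\<^sup>2" for r
  \<comment> \<open>The factor makes the lower bound for the bump integral twice the contribution of M to the
    upper bound, so that the latter is absorbed.\<close>
  define M where "M r = m r / (8 * 2 ^ ?n)" for r
  have main: "M r powr p * (V * (r / 4) ^ ?n) \<le> I" if r: "0 < r" "r \<le> 1 / 4" for r
  proof -
    define R where "R = r / 4"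
    define a where "a = r *\<^sub>R (axis k 1 :: real^'n)"
    define b where "b = bump a R"
    have R: "0 < R" "R \<le> 1 / 16" using r by (simp_all add: R_def)
    have sub: "cball a R \<subseteq> ?K"
      using r by (intro cball_subset_cball_iff[THEN iffD2]) (simp add: a_def R_def)
    then have sub': "cball a R \<subseteq> ?B" by (rule order_trans) auto
    have b: "b \<in> C1_c ?B" unfolding b_def using bump_in_C1_c[OF R(1) sub'] .
    have "r\<^sup>2 \<le> (1/4)\<^sup>2" using r by (intro power_mono) auto
    then have "ln (r\<^sup>2 / 2) < 0" using r by (simp add: power2_eq_square)
    then have "0 < 16 - ln (r\<^sup>2 / 2)" by linarith
    then have m: "0 < m r"
      unfolding m_def using r by (intro divide_pos_pos zero_less_power) auto
    then have M: "0 < M r" by (simp add: M_def)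
    have eq: "(LINT x:?B|lebesgue. dipole_grad k x $ k * b x) = (LINT x:?B|lebesgue. g x $ k * b x)"
      using has_weak_gradient_dipole[of k] g(1) b unfolding has_weak_gradient_def by simp
    have b0: "b x = 0" if "x \<notin> cball a R" for x using bump_eq_0[OF that R(1)] by (simp add: b_def)
    have bb: "0 \<le> b x" "b x \<le> R ^ 4" for x using bump_bounds by (simp_all add: b_def)
    \<comment> \<open>The factor 1/2 comes from the bound near the axis; away from the support of the bump both sides vanish.\<close>
    have low: "m r / 2 * b x \<le> - (dipole_grad k x $ k * b x)" for x
    proof (cases "x \<in> cball a R")
      case True
      have "m r / 2 \<le> - dipole_grad k x $ k"
        using dipole_grad_axis_bound[OF N r] True by (simp add: m_def a_def R_def)
      from mult_right_mono[OF this bb(1)] show ?thesis by simp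
    qed (simp add: b0)
    have "emeasure lebesgue (cball a R) < \<infinity>"
      using emeasure_bounded_finite[OF bounded_cball, of a R] by simp
    then have ind: "integrable lebesgue (indicator (cball a R) :: _ \<Rightarrow> real)"
      by (intro integrable_real_indicator) auto
    have "(m r / 2 * (R ^ 4 / 2)) * (V * (R / 2) ^ ?n)
        = (LINT x|lebesgue. indicator (ball a (R / 2)) x * (m r / 2 * (R ^ 4 / 2)))"
      using R by (simp add: content_ball V_def)
    also have "\<dots> \<le> (LINT x|lebesgue. - (indicator ?B x *\<^sub>R (dipole_grad k x $ k * b x)))"
    proof (rule integral_mono')
      note [measurable] = C1_c_measurable[OF b]
      have "set_integrable lborel ?B (\<lambda>x. dipole_grad k x $ k * b x)"
      proof (rule set_integrable_le_profile[where C = "(real ?n + 1) * R ^ 4"])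
        fix x :: "real^'n" assume x: "x \<in> ?B"
        have "\<bar>dipole_grad k x $ k\<bar> * \<bar>b x\<bar> \<le> ((real ?n + 1) * profile (real ?n) (x \<bullet> x)) * R ^ 4"
          using bb[of x]
          by (intro mult_mono order_trans[OF component_le_norm_cart norm_dipole_grad_le[OF x]]) (auto simp: profile_nonneg)
        then show "norm (dipole_grad k x $ k * b x) \<le> (real ?n + 1) * R ^ 4 * profile (real ?n) (x \<bullet> x)"
          by (simp add: abs_mult mult_ac)
      qed measurable
      then show "integrable lebesgue (\<lambda>x. - (indicator ?B x *\<^sub>R (dipole_grad k x $ k * b x)))"
        unfolding set_integrable_def by (subst integrable_completion) auto
      fix x :: "real^'n"
      have "0 \<le> m r / 2 * b x" using m bb by simp
      then show "0 \<le> - (indicator ?B x *\<^sub>R (dipole_grad k x $ k * b x))"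
        using low[of x] by (simp add: indicator_def)
      show "indicator (ball a (R / 2)) x * (m r / 2 * (R ^ 4 / 2))
          \<le> - (indicator ?B x *\<^sub>R (dipole_grad k x $ k * b x))"
      proof (cases "x \<in> ball a (R / 2)")
        case True
        then have "x \<in> cball a R" using R by auto
        then have "x \<in> ?B" using sub' by blast
        have "m r / 2 * (R ^ 4 / 2) \<le> m r / 2 * b x"
          using m bump_lower_bound[OF True] by (intro mult_left_mono) (auto simp: b_def)
        with low[of x] True \<open>x \<in> ?B\<close> show ?thesis by simp
      next
        case False
        with \<open>0 \<le> - (indicator ?B x *\<^sub>R (dipole_grad k x $ k * b x))\<close> show ?thesis by simp
      qed
    qed
    also have "\<dots> = (LINT x|lebesgue. - (indicator ?B x *\<^sub>R (g x $ k * b x)))"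
      using eq unfolding set_lebesgue_integral_def Bochner_Integration.integral_minus by simp
    also have "\<dots> \<le> (LINT x|lebesgue. R ^ 4 * (indicator (cball a R) x * M r
        + M r powr (1 - p) * (indicator ?K x *\<^sub>R norm (g x) powr p)))"
    proof (rule integral_mono')
      have "integrable lebesgue (\<lambda>x. indicator (cball a R) x * M r)"
        by (rule integrable_mult_left[OF ind])
      then show "integrable lebesgue (\<lambda>x. R ^ 4 * (indicator (cball a R) x * M r
          + M r powr (1 - p) * (indicator ?K x *\<^sub>R norm (g x) powr p)))"
        using gint unfolding set_integrable_def
        by (intro integrable_mult_right Bochner_Integration.integrable_add)
      fix x :: "real^'n"
      show nn: "0 \<le> R ^ 4 * (indicator (cball a R) x * M r + M r powr (1 - p) * (indicator ?K x *\<^sub>R norm (g x) powr p))"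
        using M by simp
      show "- (indicator ?B x *\<^sub>R (g x $ k * b x)) \<le> R ^ 4 * (indicator (cball a R) x * M r
          + M r powr (1 - p) * (indicator ?K x *\<^sub>R norm (g x) powr p))"
      proof (cases "x \<in> cball a R")
        case True
        then have x: "x \<in> ?B" "x \<in> ?K" using sub sub' by auto
        have "(- g x $ k) * b x \<le> \<bar>g x $ k\<bar> * b x"
          by (rule mult_right_mono[OF _ bb(1)]) simp
        then have "- (g x $ k * b x) \<le> \<bar>g x $ k\<bar> * b x" by simp
        also have "\<dots> \<le> norm (g x) * R ^ 4"
          by (intro mult_mono component_le_norm_cart bb) auto
        also have "\<dots> \<le> (M r + M r powr (1 - p) * norm (g x) powr p) * R ^ 4"
          using M p by (intro mult_right_mono le_add_powr) auto
        finally show ?thesis using True x by (simp add: mult.commute)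
      next
        case False
        with b0[OF False] have "- (indicator ?B x *\<^sub>R (g x $ k * b x)) = 0" by simp
        with nn show ?thesis by linarith
      qed
    qed
    also have "\<dots> = R ^ 4 * (M r * (V * R ^ ?n) + M r powr (1 - p) * I)"
    proof -
      have "integrable lebesgue (\<lambda>x. indicator (cball a R) x * M r)"
        by (rule integrable_mult_left[OF ind])
      moreover have "(LINT x|lebesgue. indicator (cball a R) x * M r) = M r * (V * R ^ ?n)"
        using R by (simp add: content_cball V_def)
      moreover have "integrable lebesgue (\<lambda>x. M r powr (1 - p) * (indicator ?K x *\<^sub>R norm (g x) powr p))"
        using gint unfolding set_integrable_def by (intro integrable_mult_right)
      moreover have "(LINT x|lebesgue. M r powr (1 - p) * (indicator ?K x *\<^sub>R norm (g x) powr p)) = M r powr (1 - p) * I"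
        unfolding I_def set_lebesgue_integral_def by (rule integral_mult_right_zero)
      ultimately show ?thesis
        unfolding integral_mult_right_zero by (subst Bochner_Integration.integral_add) auto
    qed
    finally have "(m r / 2 * (R ^ 4 / 2)) * (V * (R / 2) ^ ?n) \<le> R ^ 4 * (M r * (V * R ^ ?n) + M r powr (1 - p) * I)" .
    moreover have "(m r / 2 * (R ^ 4 / 2)) * (V * (R / 2) ^ ?n) = R ^ 4 * (2 * (M r * (V * R ^ ?n)))"
      by (simp add: M_def power_divide)
    ultimately have "2 * (M r * (V * R ^ ?n)) \<le> M r * (V * R ^ ?n) + M r powr (1 - p) * I"
      using R by (simp only: mult_le_cancel_left_pos zero_less_power)
    then have "M r * (V * R ^ ?n) \<le> M r powr (1 - p) * I" by linarith
    then have "M r powr (p - 1) * (M r * (V * R ^ ?n)) \<le> M r powr (p - 1) * (M r powr (1 - p) * I)"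
      by (rule mult_left_mono) simp
    moreover have "M r powr (p - 1) * M r = M r powr p"
      using M powr_mult_base[of "M r" "p - 1"] by (simp add: mult.commute)
    moreover have "M r powr (p - 1) * M r powr (1 - p) = 1"
      using M by (simp add: powr_add[symmetric])
    ultimately show ?thesis by (simp only: mult.assoc[symmetric] mult_1 R_def)
  qed
  define c where "c = (2 powr (- real ?n / 2) / (8 * 2 ^ ?n)) powr p * (V / 4 ^ ?n)"
  have c: "0 < c" using V by (simp add: c_def)
  have form: "M r powr p * (V * (r / 4) ^ ?n)
      = c * (r powr (- (real ?n * (p - 1))) / (16 - ln (r\<^sup>2 / 2)) powr (2 * p))" if r: "0 < r" "r \<le> 1 / 4" for r
  proof -
    define L where "L = 16 - ln (r\<^sup>2 / 2)"
    have "r\<^sup>2 \<le> (1/4)\<^sup>2" using r by (intro power_mono) auto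
    then have "ln (r\<^sup>2 / 2) < 0" using r by (simp add: power2_eq_square)
    then have L: "0 < L" by (simp add: L_def)
    have "(2 * r\<^sup>2) powr (- real ?n / 2) = 2 powr (- real ?n / 2) * (r powr 2) powr (- real ?n / 2)"
      using r by (simp add: powr_mult powr_numeral)
    also have "(r powr 2) powr (- real ?n / 2) = r powr (- real ?n)" by (simp add: powr_powr)
    finally have "M r = (2 powr (- real ?n / 2) / (8 * 2 ^ ?n)) * (r powr (- real ?n) / L powr 2)"
      using L by (simp add: M_def m_def L_def powr_numeral)
    then have "M r powr p = (2 powr (- real ?n / 2) / (8 * 2 ^ ?n)) powr p * (r powr (- real ?n) / L powr 2) powr p"
      by (simp only: powr_mult)
    also have "(r powr (- real ?n) / L powr 2) powr p = r powr (- real ?n * p) / L powr (2 * p)"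
      by (simp add: powr_divide powr_powr)
    finally have "M r powr p * (V * (r / 4) ^ ?n) = c * ((r powr (- real ?n * p) * r ^ ?n) / L powr (2 * p))"
      by (simp add: c_def power_divide mult_ac)
    also have "r powr (- real ?n * p) * r ^ ?n = r powr (- (real ?n * (p - 1)))"
      using r by (simp add: powr_realpow[symmetric] powr_add[symmetric] algebra_simps)
    finally show ?thesis by (simp add: L_def)
  qed
  have "filterlim (\<lambda>r. r powr (- (real ?n * (p - 1))) / (16 - ln (r\<^sup>2 / 2)) powr (2 * p)) at_top (at_right 0)"
    by (rule growth_at_right_0) (use p in auto)
  then have "\<forall>\<^sub>F r in at_right 0. (I + 1) / c \<le> r powr (- (real ?n * (p - 1))) / (16 - ln (r\<^sup>2 / 2)) powr (2 * p)"
    by (simp add: filterlim_at_top)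
  moreover have "\<forall>\<^sub>F r::real in at_right 0. r \<in> {0<..1/4}"
    by (rule eventually_at_rightI[of 0 "1/4"]) auto
  ultimately have "\<forall>\<^sub>F r::real in at_right 0. False"
  proof eventually_elim
    case (elim r)
    then have "I + 1 \<le> c * (r powr (- (real ?n * (p - 1))) / (16 - ln (r\<^sup>2 / 2)) powr (2 * p))"
      using c by (simp add: pos_divide_le_eq mult.commute)
    also have "\<dots> \<le> I" using elim main form by auto
    finally show False by simp
  qed
  then show False by simp
qed

theorem proposition1p2:
  assumes "CARD('n::finite) \<ge> 2"
  shows "\<exists>(u :: real^'n \<Rightarrow> real) (A :: real^'n \<Rightarrow> real^'n^'n).
    u \<in> W1p_loc 1 (ball 0 1) \<and>
    elliptic (ball 0 1) A \<and> continuous_on (ball 0 1) A \<and>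
    weak_solution (ball 0 1) A u \<and>
    (\<forall>p>1. u \<notin> W1p_loc p (ball 0 1))"
proof -
  fix k :: 'n
  have grad: "has_weak_gradient (ball 0 1) (dipole k) (dipole_grad k)"
    by (rule has_weak_gradient_dipole)
  then have W11: "dipole k \<in> W1p_loc 1 (ball 0 1)"
    unfolding W1p_loc_def has_weak_gradient_def by blast
  moreover have "weak_solution (ball 0 1) coeff_matrix (dipole k)"
    unfolding weak_solution_def
    using W11 grad flux_weakly_divergence_free[OF assms, of _ k]
    by (auto simp: coeff_matrix_mult_dipole_grad intro!: exI[of _ "dipole_grad k"])
  ultimately show ?thesis
    using elliptic_coeff_matrix[OF assms] continuous_on_coeff_matrix[OF assms] dipole_notin_W1p_loc[OF assms]
    by blast
qed

end
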